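(* For every odd integer $m$, there exists a symmetric Bush-type Hadamard matrix of order $4m^4$.
   Context: A Hadamard matrix of order $N$ is an $N\times N$ matrix $H$ with entries $\pm 1$ such that $HH^{\top}=N I_N$. For a positive integer $n$, let $J_{2n}$ denote the $2n\times 2n$ all-ones matrix. A Hadamard matrix $H$ of order $4n^2$, partitioned into $2n\times 2n$ blocks as $H=(H_{ij})_{1\le i,j\le 2n}$ (each $H_{ij}$ being a $2n\times 2n$ matrix), is said to be of Bush-type if $H_{ii}=J_{2n}$ for all $1\le i\le 2n$, and $H_{ij}J_{2n}=J_{2n}H_{ij}=0$ for all $i\ne j$, $1\le i,j\le 2n$. It is symmetric if $H=H^{\top}$. (For order $4m^4$ one has $n=m^2$.) *)

theory Defs
  imports "Jordan_Normal_Form.Matrix"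
begin

definition hadamard_mat :: "nat \<Rightarrow> int mat \<Rightarrow> bool" where
  "hadamard_mat N H \<longleftrightarrow>
     H \<in> carrier_mat N N \<and> elements_mat H \<subseteq> {1, -1} \<and>
     H * transpose_mat H = int N \<cdot>\<^sub>m 1\<^sub>m N"

definition all_ones_mat :: "nat \<Rightarrow> int mat" where
  "all_ones_mat k = mat k k (\<lambda>_. 1)"

(* Matrices are indexed from 0, so the blocks are numbered 0, 1, ... as well;
   only meaningful if the block lies inside H. *)
definition block_mat :: "nat \<Rightarrow> int mat \<Rightarrow> nat \<Rightarrow> nat \<Rightarrow> int mat" where
  "block_mat b H i j = mat b b (\<lambda>(r, c). H $$ (i * b + r, j * b + c))"

(* N determines n, so the existential only names the n with N = 4 * n^2. *)
definition bush_type_hadamard_mat :: "nat \<Rightarrow> int mat \<Rightarrow> bool" where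
  "bush_type_hadamard_mat N H \<longleftrightarrow>
     hadamard_mat N H \<and>
     (\<exists>n>0. N = 4 * n\<^sup>2 \<and>
        (\<forall>i<2*n. block_mat (2*n) H i i = all_ones_mat (2*n)) \<and>
        (\<forall>i<2*n. \<forall>j<2*n. i \<noteq> j \<longrightarrow>
           block_mat (2*n) H i j * all_ones_mat (2*n) = 0\<^sub>m (2*n) (2*n) \<and>
           all_ones_mat (2*n) * block_mat (2*n) H i j = 0\<^sub>m (2*n) (2*n)))"

end

theory Submission
  imports Defs "HOL-Number_Theory.Euler_Criterion" "HOL-Computational_Algebra.Polynomial"
begin

text \<open>The matrix is assembled from four symmetric matrices \<open>a\<^sub>0, a\<^sub>1, b\<^sub>0, b\<^sub>1\<close> of order \<open>n\<^sup>2\<close>,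
  \<open>n = m\<^sup>2\<close>, with entries in \<open>{-1, 0, 1}\<close>, such that \<open>a\<^sub>t\<close> and \<open>b\<^sub>t\<close> have complementary supports,
  \<open>a\<^sub>0 a\<^sub>1 = b\<^sub>0 b\<^sub>1 = 0\<close> and \<open>a\<^sub>0\<^sup>2 + a\<^sub>1\<^sup>2 = b\<^sub>0\<^sup>2 + b\<^sub>1\<^sup>2 = n\<^sup>2 I\<close>. Such quadruples multiply: from
  \<open>(a, b)\<close> and \<open>(a', b')\<close> one obtains \<open>(a\<^sub>t \<otimes> a'\<^sub>0 + b\<^sub>t \<otimes> a'\<^sub>1, a\<^sub>t \<otimes> b'\<^sub>0 + b\<^sub>t \<otimes> b'\<^sub>1)\<close>. So it suffices to
  treat an odd prime \<open>m = q\<close>.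

  Let \<open>F\<close> be the field of order \<open>Q = q\<^sup>2\<close> with quadratic character \<open>\<eta>\<close>. On the group \<open>F\<^sup>2\<close>, let \<open>P\<^sub>i\<close> be the
  indicator of the line \<open>F v\<^sub>i\<close>, let \<open>E\<^sub>i\<close> be \<open>\<eta>\<close> of the coordinate on this line and 0 elsewhere, let
  \<open>M\<^sub>i = \<eta>(det(v\<^sub>i, _))\<close>, and let \<open>\<epsilon>\<^sub>i\<^sub>j = \<eta>(det(v\<^sub>i, v\<^sub>j))\<close> be the Paley conference matrix. Under
  convolution, \<open>P\<^sub>i P\<^sub>i = Q P\<^sub>i\<close>, \<open>P\<^sub>i P\<^sub>j = 1\<close>, \<open>P\<^sub>i E\<^sub>j = \<epsilon>\<^sub>i\<^sub>j M\<^sub>i\<close>, and \<open>E\<^sub>i E\<^sub>j\<close> is the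
  pointwise product of \<open>M\<^sub>i\<close> and \<open>M\<^sub>j\<close> if \<open>i \<noteq> j\<close>. Suppose the lines are split into halves \<open>S\<close> and \<open>S'\<close> with signs
  \<open>u\<close> on \<open>S\<close> and \<open>u'\<close> on \<open>S'\<close> such that \<open>\<epsilon> u = q u'\<close> and \<open>\<epsilon> u' = q u\<close>. With signs \<open>\<tau>\<close> on \<open>S\<close> and
  \<open>\<tau>'\<close> on \<open>S'\<close> of sum 1, the functions \<open>a\<^sub>0 = \<Sum> \<tau>\<^sub>i P\<^sub>i\<close>, \<open>a\<^sub>1 = \<Sum> u\<^sub>i E\<^sub>i\<close>, \<open>b\<^sub>0 = \<Sum> u'\<^sub>i E\<^sub>i\<close>,
  \<open>b\<^sub>1 = \<Sum> \<tau>'\<^sub>i P\<^sub>i\<close> do the job; the blocks come from the cosets of a line with \<open>\<tau>\<^sub>i = 1\<close>. Finally \<open>u \<plusminus> u'\<close> may be any two \<open>\<plusminus>1\<close> eigenvectors of \<open>\<epsilon>\<close> for \<open>\<plusminus>q\<close>; these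
  are functions on \<open>F\<close>, extended by 1 at infinity, that are constant on parallel lines of \<open>F\<close> over
  the prime field, in a square direction for \<open>q\<close> and in a nonsquare direction for \<open>-q\<close>.\<close>

section \<open>Orthogonal pairs and seeds\<close>

definition orth_pair :: "'x set \<Rightarrow> nat \<Rightarrow> (bool \<Rightarrow> 'x \<Rightarrow> 'x \<Rightarrow> int) \<Rightarrow> bool" where
  "orth_pair X n f \<longleftrightarrow>
     (\<forall>t. \<forall>x\<in>X. \<forall>y\<in>X. f t x y = f t y x) \<and>
     (\<forall>t. \<forall>x\<in>X. \<forall>z\<in>X. (\<Sum>y\<in>X. f t x y * f (\<not> t) y z) = 0) \<and>
     (\<forall>x\<in>X. \<forall>z\<in>X. (\<Sum>y\<in>X. f False x y * f False y z) + (\<Sum>y\<in>X. f True x y * f True y z)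
        = (int n)\<^sup>2 * of_bool (x = z))"

lemma orth_pairD:
  assumes "orth_pair X n f" "x \<in> X" "z \<in> X"
  shows "f t x z = f t z x"
    and "(\<Sum>y\<in>X. f t x y * f (\<not> t) y z) = 0"
    and "(\<Sum>y\<in>X. f False x y * f False y z) + (\<Sum>y\<in>X. f True x y * f True y z)
        = (int n)\<^sup>2 * of_bool (x = z)"
  using assms unfolding orth_pair_def by blast+

lemma orth_pair_reindex:
  assumes "orth_pair X n f" and g: "bij_betw g Y X"
  shows "orth_pair Y n (\<lambda>t x y. f t (g x) (g y))"
proof -
  have gX: "g x \<in> X" if "x \<in> Y" for x
    using g that by (auto simp: bij_betw_def)
  have s: "(\<Sum>y\<in>Y. h (g y)) = sum h X" for h :: "_ \<Rightarrow> int"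
    by (rule sum.reindex_bij_betw[OF g])
  have i: "g x = g z \<longleftrightarrow> x = z" if "x \<in> Y" "z \<in> Y" for x z
    using g that by (auto simp: bij_betw_def inj_on_def)
  show ?thesis
    unfolding orth_pair_def
  proof (intro conjI ballI allI)
    fix t x y assume "x \<in> Y" "y \<in> Y"
    then show "f t (g x) (g y) = f t (g y) (g x)"
      using orth_pairD(1)[OF assms(1)] gX by blast
  next
    fix t x z assume "x \<in> Y" "z \<in> Y"
    then show "(\<Sum>y\<in>Y. f t (g x) (g y) * f (\<not> t) (g y) (g z)) = 0"
      using s[of "\<lambda>y. f t (g x) y * f (\<not> t) y (g z)"] orth_pairD(2)[OF assms(1) gX gX] by simp
  next
    fix x z assume "x \<in> Y" "z \<in> Y"
    then show "(\<Sum>y\<in>Y. f False (g x) (g y) * f False (g y) (g z)) +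
        (\<Sum>y\<in>Y. f True (g x) (g y) * f True (g y) (g z)) = (int n)\<^sup>2 * of_bool (x = z)"
      using s[of "\<lambda>y. f False (g x) y * f False y (g z)"] s[of "\<lambda>y. f True (g x) y * f True y (g z)"]
        orth_pairD(3)[OF assms(1) gX gX, of x z] i by simp
  qed
qed

lemma orth_pair_swap:
  assumes "orth_pair X n f"
  shows "orth_pair X n (\<lambda>t. f (\<not> t))"
  unfolding orth_pair_def
proof (intro conjI ballI allI)
  fix x z assume xz: "x \<in> X" "z \<in> X"
  show "f (\<not> t) x z = f (\<not> t) z x" "(\<Sum>y\<in>X. f (\<not> t) x y * f (\<not> \<not> t) y z) = 0" for t
    by (rule orth_pairD[OF assms xz])+
  show "(\<Sum>y\<in>X. f (\<not> False) x y * f (\<not> False) y z) + (\<Sum>y\<in>X. f (\<not> True) x y * f (\<not> True) y z)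
      = (int n)\<^sup>2 * of_bool (x = z)"
    using orth_pairD(3)[OF assms xz] by (simp only: not_True_eq_False not_False_eq_True add.commute)
qed

text \<open>In terms of matrices, \<open>mix a b f t\<close> is the sum of Kronecker products
  \<open>a\<^sub>t \<otimes> f\<^sub>0 + b\<^sub>t \<otimes> f\<^sub>1\<close>.\<close>

definition mix :: "(bool \<Rightarrow> 'x \<Rightarrow> 'x \<Rightarrow> int) \<Rightarrow> (bool \<Rightarrow> 'x \<Rightarrow> 'x \<Rightarrow> int) \<Rightarrow> (bool \<Rightarrow> 'y \<Rightarrow> 'y \<Rightarrow> int)
    \<Rightarrow> bool \<Rightarrow> 'x \<times> 'y \<Rightarrow> 'x \<times> 'y \<Rightarrow> int" where
  "mix a b f t p r = a t (fst p) (fst r) * f False (snd p) (snd r) + b t (fst p) (fst r) * f True (snd p) (snd r)"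

lemma sum_mix_mult:
  "(\<Sum>r\<in>X \<times> Y. mix a b f s p r * mix a b f t r q) =
     (\<Sum>y\<in>X. a s (fst p) y * a t y (fst q)) * (\<Sum>y\<in>Y. f False (snd p) y * f False y (snd q)) +
     (\<Sum>y\<in>X. a s (fst p) y * b t y (fst q)) * (\<Sum>y\<in>Y. f False (snd p) y * f True y (snd q)) +
     (\<Sum>y\<in>X. b s (fst p) y * a t y (fst q)) * (\<Sum>y\<in>Y. f True (snd p) y * f False y (snd q)) +
     (\<Sum>y\<in>X. b s (fst p) y * b t y (fst q)) * (\<Sum>y\<in>Y. f True (snd p) y * f True y (snd q))"
  unfolding sum_product sum.cartesian_product sum.distrib[symmetric] mix_def
  by (intro sum.cong refl) (auto simp: algebra_simps)

text \<open>Terms with both \<open>f False\<close> and \<open>f True\<close> vanish. In the rest,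
  the squares of \<open>a\<close> and those of \<open>b\<close> each add up to the same multiple of
  the identity, which leaves the sum of the squares of \<open>f\<close>.\<close>

lemma orth_pair_mix:
  assumes a: "orth_pair X n a" and b: "orth_pair X n b" and f: "orth_pair Y m f"
  shows "orth_pair (X \<times> Y) (n * m) (mix a b f)"
proof -
  note f0 = orth_pairD(2)[OF f, where t = False, simplified] orth_pairD(2)[OF f, where t = True, simplified]
  show ?thesis
    unfolding orth_pair_def
  proof (intro conjI ballI allI)
    fix t p q assume "p \<in> X \<times> Y" "q \<in> X \<times> Y"
    then show "mix a b f t p q = mix a b f t q p"
      using orth_pairD(1)[OF a] orth_pairD(1)[OF b] orth_pairD(1)[OF f] unfolding mix_def
      by (metis mem_Times_iff)
  next
    fix t p q assume "p \<in> X \<times> Y" "q \<in> X \<times> Y"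
    then have pq: "fst p \<in> X" "fst q \<in> X" "snd p \<in> Y" "snd q \<in> Y" by auto
    show "(\<Sum>r\<in>X \<times> Y. mix a b f t p r * mix a b f (\<not> t) r q) = 0"
      unfolding sum_mix_mult
      using orth_pairD(2)[OF a pq(1,2), of t] orth_pairD(2)[OF b pq(1,2), of t] f0[OF pq(3,4)]
      by simp
  next
    fix p q assume "p \<in> X \<times> Y" "q \<in> X \<times> Y"
    then have pq: "fst p \<in> X" "fst q \<in> X" "snd p \<in> Y" "snd q \<in> Y" by auto
    have "(\<Sum>r\<in>X \<times> Y. mix a b f False p r * mix a b f False r q) +
        (\<Sum>r\<in>X \<times> Y. mix a b f True p r * mix a b f True r q) =
        ((\<Sum>y\<in>X. a False (fst p) y * a False y (fst q)) + (\<Sum>y\<in>X. a True (fst p) y * a True y (fst q)))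
          * (\<Sum>y\<in>Y. f False (snd p) y * f False y (snd q)) +
        ((\<Sum>y\<in>X. b False (fst p) y * b False y (fst q)) + (\<Sum>y\<in>X. b True (fst p) y * b True y (fst q)))
          * (\<Sum>y\<in>Y. f True (snd p) y * f True y (snd q))"
      by (simp only: sum_mix_mult f0[OF pq(3,4)] mult_zero_right add_0_right distrib_right add_ac)
    also have "\<dots> = (int n)\<^sup>2 * of_bool (fst p = fst q) *
        ((\<Sum>y\<in>Y. f False (snd p) y * f False y (snd q)) + (\<Sum>y\<in>Y. f True (snd p) y * f True y (snd q)))"
      unfolding orth_pairD(3)[OF a pq(1,2)] orth_pairD(3)[OF b pq(1,2)] by (simp only: distrib_left)
    also have "\<dots> = (int (n * m))\<^sup>2 * of_bool (p = q)"
      unfolding orth_pairD(3)[OF f pq(3,4)] by (simp add: prod_eq_iff power_mult_distrib)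
    finally show "(\<Sum>r\<in>X \<times> Y. mix a b f False p r * mix a b f False r q) +
        (\<Sum>r\<in>X \<times> Y. mix a b f True p r * mix a b f True r q) = (int (n * m))\<^sup>2 * of_bool (p = q)" .
  qed
qed

text \<open>\<open>B\<close> numbers the blocks and \<open>C\<close> the places in a block. Symmetry
  turns row sums into column sums. They are demanded of \<open>a\<close> alone, as \<open>b\<close>
  will be multiplied by a matrix with row sums 0. For \<open>t = True\<close> every
  \<open>\<beta>\<close> is covered, because a further bit of the block number will differ
  there.\<close>

locale bush_seed =
  fixes B :: "'b set" and C :: "'c set" and n :: nat
    and a b :: "bool \<Rightarrow> 'b \<times> 'c \<Rightarrow> 'b \<times> 'c \<Rightarrow> int"
  assumes card_B: "card B = n" and card_C: "card C = n" and n_pos: "n > 0"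
    and a: "orth_pair (B \<times> C) n a" and b: "orth_pair (B \<times> C) n b"
    and support: "\<And>t x y. x \<in> B \<times> C \<Longrightarrow> y \<in> B \<times> C \<Longrightarrow> \<bar>a t x y\<bar> + \<bar>b t x y\<bar> = 1"
    and diagonal: "\<And>x y. x \<in> B \<times> C \<Longrightarrow> y \<in> B \<times> C \<Longrightarrow> fst x = fst y \<Longrightarrow> a False x y = 1"
    and block_sum: "\<And>t x \<beta>. x \<in> B \<times> C \<Longrightarrow> \<beta> \<in> B \<Longrightarrow> t \<or> \<beta> \<noteq> fst x \<Longrightarrow> (\<Sum>\<gamma>\<in>C. a t x (\<beta>, \<gamma>)) = 0"
begin

lemma finite_B: "finite B" and finite_C: "finite C"
  using card_B card_C n_pos by (auto intro: card_ge_0_finite)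

lemma b_diagonal:
  assumes "x \<in> B \<times> C" "y \<in> B \<times> C" "fst x = fst y" shows "b False x y = 0"
  using support[OF assms(1,2), of False] diagonal[OF assms] by simp

lemma reindex:
  assumes g: "bij_betw g B' B" and h: "bij_betw h C' C"
  shows "bush_seed B' C' n (\<lambda>t x y. a t (map_prod g h x) (map_prod g h y))
           (\<lambda>t x y. b t (map_prod g h x) (map_prod g h y))"
proof
  show "card B' = n" "card C' = n"
    using bij_betw_same_card[OF g] bij_betw_same_card[OF h] card_B card_C by auto
  show "n > 0" by (rule n_pos)
  have gh: "bij_betw (map_prod g h) (B' \<times> C') (B \<times> C)"
    by (rule bij_betw_map_prod[OF g h])
  show "orth_pair (B' \<times> C') n (\<lambda>t x y. a t (map_prod g h x) (map_prod g h y))"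
    "orth_pair (B' \<times> C') n (\<lambda>t x y. b t (map_prod g h x) (map_prod g h y))"
    using orth_pair_reindex[OF a gh] orth_pair_reindex[OF b gh] .
  have mem: "map_prod g h x \<in> B \<times> C" if "x \<in> B' \<times> C'" for x
    using gh that by (auto simp: bij_betw_def)
  show "\<bar>a t (map_prod g h x) (map_prod g h y)\<bar> + \<bar>b t (map_prod g h x) (map_prod g h y)\<bar> = 1"
    if "x \<in> B' \<times> C'" "y \<in> B' \<times> C'" for t x y
    using support mem that by blast
  show "a False (map_prod g h x) (map_prod g h y) = 1"
    if "x \<in> B' \<times> C'" "y \<in> B' \<times> C'" "fst x = fst y" for x y
    using diagonal[OF mem mem] that by simp
  show "(\<Sum>\<gamma>\<in>C'. a t (map_prod g h x) (map_prod g h (\<beta>, \<gamma>))) = 0"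
    if "x \<in> B' \<times> C'" "\<beta> \<in> B'" "t \<or> \<beta> \<noteq> fst x" for t x \<beta>
  proof -
    have 1: "g \<beta> \<in> B" using g that by (auto simp: bij_betw_def)
    have 2: "t \<or> g \<beta> \<noteq> fst (map_prod g h x)"
      using g that by (auto simp: bij_betw_def inj_on_def)
    show ?thesis
      using sum.reindex_bij_betw[OF h, of "\<lambda>\<gamma>. a t (map_prod g h x) (g \<beta>, \<gamma>)"]
        block_sum[OF mem[OF that(1)] 1 2] by simp
  qed
qed

text \<open>Multiplying seeds changes the index types; returning to the naturals keeps an induction
  on prime factors within one type.\<close>

lemma nat_seed: "\<exists>a b. bush_seed {..<n} {..<n} n a b"
proof -
  obtain g h where "bij_betw g {..<n} B" "bij_betw h {..<n} C"
    using ex_bij_betw_nat_finite[OF finite_B] ex_bij_betw_nat_finite[OF finite_C] card_B card_C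
    by (auto simp: atLeast0LessThan)
  from reindex[OF this] show ?thesis by blast
qed

end

lemma bush_seed_mult:
  assumes "bush_seed B C n a b" and "bush_seed B' C' n' a' b'"
  shows "\<exists>c d. bush_seed (B \<times> B') (C \<times> C') (n * n') c d"
proof -
  interpret S: bush_seed B C n a b by fact
  interpret S': bush_seed B' C' n' a' b' by fact
  \<comment> \<open>Blocks of the product need the coordinates from \<open>B\<close> and
    \<open>B'\<close> together, whereas \<open>mix\<close> needs those of each factor
    together.\<close>
  define sw :: "('a \<times> 'c) \<times> ('b \<times> 'd) \<Rightarrow> ('a \<times> 'b) \<times> ('c \<times> 'd)"
    where "sw = (\<lambda>((i, i'), (j, j')). ((i, j), (i', j')))"
  have sw: "bij_betw sw ((B \<times> B') \<times> (C \<times> C')) ((B \<times> C) \<times> (B' \<times> C'))"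
    by (rule bij_betwI[where g = "\<lambda>((i, j), (i', j')). ((i, i'), (j, j'))"]) (auto simp: sw_def)
  have sw_mem: "fst (sw x) \<in> B \<times> C" "snd (sw x) \<in> B' \<times> C'" if "x \<in> (B \<times> B') \<times> (C \<times> C')" for x
    using that by (auto simp: sw_def)
  have "bush_seed (B \<times> B') (C \<times> C') (n * n') (\<lambda>t x y. mix a b a' t (sw x) (sw y))
      (\<lambda>t x y. mix a b b' t (sw x) (sw y))"
  proof
    show "card (B \<times> B') = n * n'" "card (C \<times> C') = n * n'" "n * n' > 0"
      using S.card_B S.card_C S.n_pos S'.card_B S'.card_C S'.n_pos by (auto simp: card_cartesian_product)
    show "orth_pair ((B \<times> B') \<times> (C \<times> C')) (n * n') (\<lambda>t x y. mix a b a' t (sw x) (sw y))"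
      "orth_pair ((B \<times> B') \<times> (C \<times> C')) (n * n') (\<lambda>t x y. mix a b b' t (sw x) (sw y))"
      using orth_pair_reindex[OF orth_pair_mix[OF S.a S.b S'.a] sw]
        orth_pair_reindex[OF orth_pair_mix[OF S.a S.b S'.b] sw] .
  next
    fix t x y assume xy: "x \<in> (B \<times> B') \<times> (C \<times> C')" "y \<in> (B \<times> B') \<times> (C \<times> C')"
    have *: "a t u v = 0 \<and> \<bar>b t u v\<bar> = 1 \<or> \<bar>a t u v\<bar> = 1 \<and> b t u v = 0"
      if "u \<in> B \<times> C" "v \<in> B \<times> C" for u v
      using S.support[OF that, of t] by (auto simp: abs_if split: if_splits)
    show "\<bar>mix a b a' t (sw x) (sw y)\<bar> + \<bar>mix a b b' t (sw x) (sw y)\<bar> = 1"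
      using *[OF sw_mem(1)[OF xy(1)] sw_mem(1)[OF xy(2)]]
        S'.support[OF sw_mem(2)[OF xy(1)] sw_mem(2)[OF xy(2)]]
      by (auto simp: mix_def abs_mult)
  next
    fix x y assume xy: "x \<in> (B \<times> B') \<times> (C \<times> C')" "y \<in> (B \<times> B') \<times> (C \<times> C')" and e: "fst x = fst y"
    from e have e': "fst (fst (sw x)) = fst (fst (sw y))" "fst (snd (sw x)) = fst (snd (sw y))"
      by (auto simp: sw_def split: prod.splits)
    note m = sw_mem[OF xy(1)] sw_mem[OF xy(2)]
    show "mix a b a' False (sw x) (sw y) = 1"
      unfolding mix_def
      using S.diagonal[OF m(1,3) e'(1)] S'.diagonal[OF m(2,4) e'(2)] S.b_diagonal[OF m(1,3) e'(1)] by simp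
  next
    fix t x \<beta> assume x: "x \<in> (B \<times> B') \<times> (C \<times> C')" and \<beta>: "\<beta> \<in> B \<times> B'" and t: "t \<or> \<beta> \<noteq> fst x"
    note m = sw_mem[OF x]
    obtain \<beta>1 \<beta>2 where \<beta>': "\<beta> = (\<beta>1, \<beta>2)" "\<beta>1 \<in> B" "\<beta>2 \<in> B'" using \<beta> by auto
    have f: "fst x = (fst (fst (sw x)), fst (snd (sw x)))"
      by (auto simp: sw_def split: prod.splits)
    have "(\<Sum>\<gamma>\<in>C \<times> C'. mix a b a' t (sw x) (sw (\<beta>, \<gamma>))) =
        (\<Sum>\<gamma>\<in>C. a t (fst (sw x)) (\<beta>1, \<gamma>)) * (\<Sum>\<gamma>\<in>C'. a' False (snd (sw x)) (\<beta>2, \<gamma>)) +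
        (\<Sum>\<gamma>\<in>C. b t (fst (sw x)) (\<beta>1, \<gamma>)) * (\<Sum>\<gamma>\<in>C'. a' True (snd (sw x)) (\<beta>2, \<gamma>))"
      unfolding sum_product sum.cartesian_product sum.distrib[symmetric]
      by (intro sum.cong refl) (auto simp: mix_def sw_def \<beta>')
    \<comment> \<open>Sums of \<open>a' True\<close> always vanish, which removes the second term.
      In the first, \<open>a t\<close> sums to 0 if \<open>t\<close> holds or
      \<open>\<beta>1\<close> is off the diagonal; otherwise \<open>\<beta>2\<close> is off it and
      \<open>a' False\<close> sums to 0.\<close>
    also have "\<dots> = 0"
      using t f \<beta>' S.block_sum[OF m(1) \<beta>'(2), of t] S'.block_sum[OF m(2) \<beta>'(3), of False]
        S'.block_sum[OF m(2) \<beta>'(3), of True]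
      by auto
    finally show "(\<Sum>\<gamma>\<in>C \<times> C'. mix a b a' t (sw x) (sw (\<beta>, \<gamma>))) = 0" .
  qed
  then show ?thesis by blast
qed

lemma bush_seed_1: "bush_seed {..<1::nat} {..<1::nat} 1 (\<lambda>t x y. of_bool (\<not> t)) (\<lambda>t x y. of_bool t)"
  by standard (auto simp: orth_pair_def lessThan_Suc)

section \<open>From seeds to Bush-type matrices\<close>

lemma sum_div_mod:
  fixes f :: "nat \<Rightarrow> nat \<Rightarrow> int"
  shows "(\<Sum>r<m * m. f (r div m) (r mod m)) = (\<Sum>i<m. \<Sum>j<m. f i j)"
proof -
  have "(\<Sum>r<m * m. f (r div m) (r mod m)) = (\<Sum>p\<in>{..<m} \<times> {..<m}. f (fst p) (snd p))"
  proof (rule sum.reindex_bij_witness[where i = "\<lambda>p. fst p * m + snd p" and j = "\<lambda>r. (r div m, r mod m)"])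
    fix r assume "r \<in> {..<m * m}"
    then show "(r div m, r mod m) \<in> {..<m} \<times> {..<m}"
      by (cases "m = 0") (auto simp: less_mult_imp_div_less)
  next
    fix p assume p: "p \<in> {..<m} \<times> {..<m}"
    then have "fst p * m + snd p < fst p * m + m" by auto
    also have "\<dots> = (fst p + 1) * m" by simp
    also have "\<dots> \<le> m * m" using p by (intro mult_right_mono) auto
    finally show "fst p * m + snd p \<in> {..<m * m}" by simp
  qed auto
  then show ?thesis by (simp add: sum.cartesian_product case_prod_unfold)
qed

lemma sum_double:
  fixes f :: "bool \<Rightarrow> nat \<Rightarrow> int"
  shows "(\<Sum>i<2 * n. f (n \<le> i) (i mod n)) = (\<Sum>j<n. f False j + f True j)"
proof -
  have "(\<Sum>i<2 * n. f (n \<le> i) (i mod n)) = (\<Sum>i<n. f (n \<le> i) (i mod n)) + (\<Sum>i\<in>{n..<2 * n}. f (n \<le> i) (i mod n))"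
    by (subst sum.union_disjoint[symmetric]) (auto intro: sum.cong)
  also have "(\<Sum>i\<in>{n..<2 * n}. f (n \<le> i) (i mod n)) = (\<Sum>i<n. f True i)"
    by (rule sum.reindex_bij_witness[where i = "\<lambda>j. j + n" and j = "\<lambda>i. i - n"])
       (auto simp: mod_if[of _ n])
  also have "(\<Sum>i<n. f (n \<le> i) (i mod n)) = (\<Sum>i<n. f False i)"
    by (intro sum.cong) auto
  finally show ?thesis by (simp add: sum.distrib)
qed

text \<open>An index below \<open>4 * n\<^sup>2\<close> encodes two bits and a point of the square \<open>{..<n} \<times> {..<n}\<close>: its
  quotient by \<open>2 * n\<close>, which is the number of its block, gives the first bit and the first coordinate, and
  its remainder the others. With \<open>X\<close> the transposition of the first bit, \<open>J\<close> the all-ones matrix on the second bit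
  and \<open>R = [[1, -1], [-1, 1]]\<close>, the matrix with entries \<open>bush_entry\<close> is the sum over \<open>t\<close> of
  \<open>X\<^sup>t \<otimes> (a\<^sub>t \<otimes> J + b\<^sub>t \<otimes> R)\<close>.\<close>

definition agree :: "bool \<Rightarrow> bool \<Rightarrow> int" where
  "agree s t = (if s = t then 1 else -1)"

lemma agree_commute: "agree s t = agree t s"
  by (auto simp: agree_def)

definition pos :: "nat \<Rightarrow> nat \<Rightarrow> nat \<times> nat" where
  "pos n r = (r div (2 * n) mod n, r mod (2 * n) mod n)"

definition bush_entry :: "nat \<Rightarrow> (bool \<Rightarrow> nat \<times> nat \<Rightarrow> nat \<times> nat \<Rightarrow> int) \<Rightarrow> (bool \<Rightarrow> nat \<times> nat \<Rightarrow> nat \<times> nat \<Rightarrow> int)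
    \<Rightarrow> nat \<Rightarrow> nat \<Rightarrow> int" where
  "bush_entry n a b r s =
     (let t = ((n \<le> r div (2 * n)) \<noteq> (n \<le> s div (2 * n)))
      in a t (pos n r) (pos n s) + agree (n \<le> r mod (2 * n)) (n \<le> s mod (2 * n)) * b t (pos n r) (pos n s))"

lemma double_mod_eqI:
  fixes i j n :: nat
  assumes "i < 2 * n" "j < 2 * n" "(n \<le> i) = (n \<le> j)" "i mod n = j mod n"
  shows "i = j"
  using assms by (auto simp: mod_if[of _ n] split: if_splits)

lemma index_eqI:
  assumes "r < 4 * n\<^sup>2" "s < 4 * n\<^sup>2"
    and "(n \<le> r div (2 * n)) = (n \<le> s div (2 * n))" "(n \<le> r mod (2 * n)) = (n \<le> s mod (2 * n))"
    and "pos n r = pos n s"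
  shows "r = s"
proof -
  have n: "n > 0" using assms(1) by (cases "n = 0") auto
  have "r div (2 * n) < 2 * n" "s div (2 * n) < 2 * n"
    using assms(1,2) by (auto simp: power2_eq_square intro!: less_mult_imp_div_less)
  then have 1: "r div (2 * n) = s div (2 * n)"
    using double_mod_eqI assms by (simp add: pos_def)
  have 2: "r mod (2 * n) = s mod (2 * n)"
    using double_mod_eqI[of "r mod (2 * n)" n "s mod (2 * n)"] assms n by (simp add: pos_def)
  show ?thesis using 1 2 by (metis div_mult_mod_eq)
qed

context bush_seed
begin

text \<open>Here \<open>X * X = 1\<close>, \<open>J * J = 2 * J\<close>,
  \<open>R * R = 2 * R\<close> and \<open>J * R = R * J = 0\<close>, so no product of
  \<open>a\<close> with \<open>b\<close> is left.\<close>

lemma summand_expand: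
  fixes x y z :: "'b \<times> 'c" and k1 k2 l1 l2 :: bool
  shows "(\<Sum>k\<in>UNIV. \<Sum>l\<in>UNIV. (a (k1 \<noteq> k) x y + agree l1 l * b (k1 \<noteq> k) x y) *
        (a (k \<noteq> k2) y z + agree l l2 * b (k \<noteq> k2) y z)) =
     (if k1 = k2 then 2 * (a False x y * a False y z) + 2 * (a True x y * a True y z) +
          2 * agree l1 l2 * (b False x y * b False y z) + 2 * agree l1 l2 * (b True x y * b True y z)
      else 2 * (a False x y * a True y z) + 2 * (a True x y * a False y z) +
          2 * agree l1 l2 * (b False x y * b True y z) + 2 * agree l1 l2 * (b True x y * b False y z))"
  by (cases k1; cases k2; cases l1; cases l2; simp add: UNIV_bool agree_def algebra_simps)

text \<open>If the first bits agree, the squares of \<open>a\<close> and of \<open>b\<close> give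
  the same multiple of the identity, and \<open>J + R\<close> is twice the identity. If not, each
  sum is a vanishing product.\<close>

lemma sum_expand:
  fixes k1 k2 :: bool
  assumes "x \<in> B \<times> C" "z \<in> B \<times> C"
  shows "(\<Sum>y\<in>B \<times> C. \<Sum>k\<in>UNIV. \<Sum>l\<in>UNIV. (a (k1 \<noteq> k) x y + agree l1 l * b (k1 \<noteq> k) x y) *
        (a (k \<noteq> k2) y z + agree l l2 * b (k \<noteq> k2) y z)) =
     4 * (int n)\<^sup>2 * of_bool (k1 = k2 \<and> l1 = l2 \<and> x = z)"
proof (cases "k1 = k2")
  case True
  have "(\<Sum>y\<in>B \<times> C. \<Sum>k\<in>UNIV. \<Sum>l\<in>UNIV. (a (k1 \<noteq> k) x y + agree l1 l * b (k1 \<noteq> k) x y) *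
        (a (k \<noteq> k2) y z + agree l l2 * b (k \<noteq> k2) y z)) =
     2 * ((\<Sum>y\<in>B \<times> C. a False x y * a False y z) + (\<Sum>y\<in>B \<times> C. a True x y * a True y z)) +
     2 * agree l1 l2 * ((\<Sum>y\<in>B \<times> C. b False x y * b False y z) + (\<Sum>y\<in>B \<times> C. b True x y * b True y z))"
    unfolding summand_expand using True
    by (simp only: if_True simp_thms sum.distrib sum_distrib_left[symmetric] distrib_left add_ac)
  also have "\<dots> = 4 * (int n)\<^sup>2 * of_bool (k1 = k2 \<and> l1 = l2 \<and> x = z)"
    unfolding orth_pairD(3)[OF a assms] orth_pairD(3)[OF b assms] using True by (simp add: agree_def)
  finally show ?thesis .
next
  case False
  have "(\<Sum>y\<in>B \<times> C. \<Sum>k\<in>UNIV. \<Sum>l\<in>UNIV. (a (k1 \<noteq> k) x y + agree l1 l * b (k1 \<noteq> k) x y) *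
        (a (k \<noteq> k2) y z + agree l l2 * b (k \<noteq> k2) y z)) =
     2 * (\<Sum>y\<in>B \<times> C. a False x y * a True y z) + 2 * (\<Sum>y\<in>B \<times> C. a True x y * a False y z) +
     2 * agree l1 l2 * (\<Sum>y\<in>B \<times> C. b False x y * b True y z) +
     2 * agree l1 l2 * (\<Sum>y\<in>B \<times> C. b True x y * b False y z)"
    unfolding summand_expand using False
    by (simp only: if_False sum.distrib sum_distrib_left[symmetric] distrib_left add_ac)
  also have "\<dots> = 0"
    using orth_pairD(2)[OF a assms, of False] orth_pairD(2)[OF a assms, of True]
      orth_pairD(2)[OF b assms, of False] orth_pairD(2)[OF b assms, of True] by simp
  finally show ?thesis using False by simp
qed

end

lemma bush_entry_sym:
  assumes "bush_seed {..<n} {..<n} n a b"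
  shows "bush_entry n a b r s = bush_entry n a b s r"
proof -
  interpret bush_seed "{..<n}" "{..<n}" n a b by fact
  have p: "pos n i \<in> {..<n} \<times> {..<n}" for i using n_pos by (simp add: pos_def)
  have "((n \<le> r div (2 * n)) \<noteq> (n \<le> s div (2 * n))) = ((n \<le> s div (2 * n)) \<noteq> (n \<le> r div (2 * n)))"
    by blast
  then show ?thesis
    unfolding bush_entry_def Let_def
    by (simp only: orth_pairD(1)[OF a p p, of _ r s] orth_pairD(1)[OF b p p, of _ r s] agree_commute)
qed

text \<open>The matrix is symmetric, so its square is its product with its transpose.\<close>

lemma bush_entry_orthogonal:
  assumes "bush_seed {..<n} {..<n} n a b" and "r < 4 * n\<^sup>2" "s < 4 * n\<^sup>2"
  shows "(\<Sum>i<4 * n\<^sup>2. bush_entry n a b r i * bush_entry n a b i s) = 4 * (int n)\<^sup>2 * of_bool (r = s)"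
proof -
  interpret bush_seed "{..<n}" "{..<n}" n a b by fact
  have p: "pos n i \<in> {..<n} \<times> {..<n}" for i using n_pos by (simp add: pos_def)
  define g where "g k l y = (a ((n \<le> r div (2 * n)) \<noteq> k) (pos n r) y +
        agree (n \<le> r mod (2 * n)) l * b ((n \<le> r div (2 * n)) \<noteq> k) (pos n r) y) *
      (a (k \<noteq> (n \<le> s div (2 * n))) y (pos n s) +
        agree l (n \<le> s mod (2 * n)) * b (k \<noteq> (n \<le> s div (2 * n))) y (pos n s))" for k l y
  have N: "4 * n\<^sup>2 = (2 * n) * (2 * n)" by (simp add: power2_eq_square)
  have "(\<Sum>i<4 * n\<^sup>2. bush_entry n a b r i * bush_entry n a b i s) =
      (\<Sum>i<(2 * n) * (2 * n). g (n \<le> i div (2 * n)) (n \<le> i mod (2 * n)) (i div (2 * n) mod n, i mod (2 * n) mod n))"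
    unfolding N by (intro sum.cong refl) (simp add: bush_entry_def Let_def g_def pos_def)
  also have "\<dots> = (\<Sum>i<2 * n. \<Sum>j<2 * n. g (n \<le> i) (n \<le> j) (i mod n, j mod n))"
    by (rule sum_div_mod[where f = "\<lambda>i j. g (n \<le> i) (n \<le> j) (i mod n, j mod n)"])
  also have "\<dots> = (\<Sum>i<2 * n. \<Sum>j<n. g (n \<le> i) False (i mod n, j) + g (n \<le> i) True (i mod n, j))"
    by (intro sum.cong refl sum_double[where f = "\<lambda>l j. g _ l (_, j)"])
  also have "\<dots> = (\<Sum>i<n. (\<Sum>j<n. g False False (i, j) + g False True (i, j)) +
      (\<Sum>j<n. g True False (i, j) + g True True (i, j)))"
    by (rule sum_double[where f = "\<lambda>k i. \<Sum>j<n. g k False (i, j) + g k True (i, j)"])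
  also have "\<dots> = (\<Sum>y\<in>{..<n} \<times> {..<n}. \<Sum>k\<in>UNIV. \<Sum>l\<in>UNIV. g k l y)"
    by (simp add: sum.distrib[symmetric] sum.cartesian_product case_prod_unfold UNIV_bool)
  also have "\<dots> = 4 * (int n)\<^sup>2 * of_bool ((n \<le> r div (2 * n)) = (n \<le> s div (2 * n)) \<and>
      (n \<le> r mod (2 * n)) = (n \<le> s mod (2 * n)) \<and> pos n r = pos n s)"
    unfolding g_def by (rule sum_expand[OF p p])
  also have "\<dots> = 4 * (int n)\<^sup>2 * of_bool (r = s)"
    using index_eqI[OF assms(2,3)] by auto
  finally show ?thesis .
qed

lemma bush_entry_block_sum:
  assumes "bush_seed {..<n} {..<n} n a b" and "r < 4 * n\<^sup>2" "i < 2 * n" "i \<noteq> r div (2 * n)"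
  shows "(\<Sum>j<2 * n. bush_entry n a b r (i * (2 * n) + j)) = 0"
proof -
  interpret bush_seed "{..<n}" "{..<n}" n a b by fact
  have p: "pos n i \<in> {..<n} \<times> {..<n}" for i using n_pos by (simp add: pos_def)
  define t where "t = ((n \<le> r div (2 * n)) \<noteq> (n \<le> i))"
  have r: "r div (2 * n) < 2 * n"
    using assms(2) by (auto simp: power2_eq_square intro!: less_mult_imp_div_less)
  have t: "t \<or> i mod n \<noteq> fst (pos n r)"
    using double_mod_eqI[OF assms(3) r] assms(4) by (auto simp: t_def pos_def)
  define g where "g l y = a t (pos n r) (i mod n, y) + agree (n \<le> r mod (2 * n)) l * b t (pos n r) (i mod n, y)" for l y
  have "(\<Sum>j<2 * n. bush_entry n a b r (i * (2 * n) + j)) = (\<Sum>j<2 * n. g (n \<le> j) (j mod n))"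
    by (intro sum.cong refl) (simp add: bush_entry_def Let_def t_def g_def pos_def)
  also have "\<dots> = (\<Sum>j<n. g False j + g True j)"
    by (rule sum_double)
  \<comment> \<open>The two values of the second bit give \<open>b\<close> opposite signs.\<close>
  also have "\<dots> = 2 * (\<Sum>j<n. a t (pos n r) (i mod n, j))"
    unfolding sum_distrib_left by (intro sum.cong refl) (auto simp: g_def agree_def)
  also have "\<dots> = 0"
    using block_sum[OF p _ t] n_pos by simp
  finally show ?thesis .
qed

lemma bush_entry_diagonal:
  assumes "bush_seed {..<n} {..<n} n a b" and "r div (2 * n) = s div (2 * n)"
  shows "bush_entry n a b r s = 1"
proof -
  interpret bush_seed "{..<n}" "{..<n}" n a b by fact
  have p: "pos n i \<in> {..<n} \<times> {..<n}" for i using n_pos by (simp add: pos_def)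
  have "fst (pos n r) = fst (pos n s)" using assms(2) by (simp add: pos_def)
  with diagonal[OF p p this] b_diagonal[OF p p this] assms(2) show ?thesis
    by (simp add: bush_entry_def)
qed

lemma bush_entry_unit:
  assumes "bush_seed {..<n} {..<n} n a b"
  shows "bush_entry n a b r s \<in> {1, -1}"
proof -
  interpret bush_seed "{..<n}" "{..<n}" n a b by fact
  have p: "pos n i \<in> {..<n} \<times> {..<n}" for i using n_pos by (simp add: pos_def)
  have "u + agree k l * v \<in> {1, -1}" if "\<bar>u\<bar> + \<bar>v\<bar> = 1" for u v :: int and k l
  proof -
    have "u + v = 1 \<or> u + v = -1" "u - v = 1 \<or> u - v = -1"
      using that by presburger+
    then show ?thesis by (auto simp: agree_def)
  qed
  then show ?thesis
    using support[OF p p] unfolding bush_entry_def Let_def by blast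
qed

lemma bush_seed_imp_bush_type:
  assumes "bush_seed {..<n} {..<n} n a b"
  shows "\<exists>H. bush_type_hadamard_mat (4 * n\<^sup>2) H \<and> transpose_mat H = H"
proof -
  interpret bush_seed "{..<n}" "{..<n}" n a b by fact
  define N where "N = 4 * n\<^sup>2"
  define H where "H = mat N N (\<lambda>(r, s). bush_entry n a b r s)"
  note sym = bush_entry_sym[OF assms]
  have H: "H \<in> carrier_mat N N" by (simp add: H_def)
  have tr: "transpose_mat H = H"
    by (rule eq_matI) (auto simp: H_def sym)
  have lt: "i * (2 * n) + r < N" if "i < 2 * n" "r < 2 * n" for i r
  proof -
    have "i * (2 * n) + r < (i + 1) * (2 * n)" using that by simp
    also have "\<dots> \<le> 2 * n * (2 * n)" using that by (intro mult_right_mono) auto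
    finally show ?thesis by (simp add: N_def power2_eq_square)
  qed
  have dv: "(i * (2 * n) + r) div (2 * n) = i" if "r < 2 * n" for i r
    using that by simp
  have sq: "H * transpose_mat H = int N \<cdot>\<^sub>m 1\<^sub>m N"
  proof (rule eq_matI)
    fix r s assume "r < dim_row (int N \<cdot>\<^sub>m 1\<^sub>m N)" "s < dim_col (int N \<cdot>\<^sub>m 1\<^sub>m N)"
    then have rs: "r < N" "s < N" by auto
    have "(H * transpose_mat H) $$ (r, s) = (\<Sum>i<N. bush_entry n a b r i * bush_entry n a b i s)"
      using rs unfolding tr by (simp add: H_def scalar_prod_def atLeast0LessThan)
    also have "\<dots> = int N * of_bool (r = s)"
      using bush_entry_orthogonal[OF assms] rs by (simp add: N_def)
    finally show "(H * transpose_mat H) $$ (r, s) = (int N \<cdot>\<^sub>m 1\<^sub>m N) $$ (r, s)"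
      using rs by simp
  qed (auto simp: H_def)
  have el: "elements_mat H \<subseteq> {1, -1}"
    using bush_entry_unit[OF assms] by (auto simp: elements_mat_def H_def)
  have blk: "block_mat (2 * n) H i i = all_ones_mat (2 * n)" if "i < 2 * n" for i
    by (rule eq_matI)
       (use that lt in \<open>auto simp: block_mat_def all_ones_mat_def H_def dv intro!: bush_entry_diagonal[OF assms]\<close>)
  have row: "(\<Sum>j<2 * n. H $$ (i * (2 * n) + r, k * (2 * n) + j)) = 0"
    if "i < 2 * n" "k < 2 * n" "i \<noteq> k" "r < 2 * n" for i k r
  proof -
    have "(\<Sum>j<2 * n. H $$ (i * (2 * n) + r, k * (2 * n) + j)) =
        (\<Sum>j<2 * n. bush_entry n a b (i * (2 * n) + r) (k * (2 * n) + j))"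
      using that lt by (intro sum.cong refl) (simp add: H_def)
    also have "\<dots> = 0"
      using bush_entry_block_sum[OF assms lt[unfolded N_def], of i r k] that dv by simp
    finally show ?thesis .
  qed
  have col: "(\<Sum>j<2 * n. H $$ (i * (2 * n) + j, k * (2 * n) + r)) = 0"
    if "i < 2 * n" "k < 2 * n" "i \<noteq> k" "r < 2 * n" for i k r
  proof -
    have "(\<Sum>j<2 * n. H $$ (i * (2 * n) + j, k * (2 * n) + r)) =
        (\<Sum>j<2 * n. H $$ (k * (2 * n) + r, i * (2 * n) + j))"
      using that lt by (intro sum.cong refl) (simp add: H_def sym)
    then show ?thesis using row that by simp
  qed
  have off: "block_mat (2 * n) H i k * all_ones_mat (2 * n) = 0\<^sub>m (2 * n) (2 * n) \<and>
      all_ones_mat (2 * n) * block_mat (2 * n) H i k = 0\<^sub>m (2 * n) (2 * n)"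
    if "i < 2 * n" "k < 2 * n" "i \<noteq> k" for i k
  proof
    show "block_mat (2 * n) H i k * all_ones_mat (2 * n) = 0\<^sub>m (2 * n) (2 * n)"
      by (rule eq_matI)
         (use row[OF that] in \<open>auto simp: block_mat_def all_ones_mat_def scalar_prod_def atLeast0LessThan\<close>)
    show "all_ones_mat (2 * n) * block_mat (2 * n) H i k = 0\<^sub>m (2 * n) (2 * n)"
      by (rule eq_matI)
         (use col[OF that] in \<open>auto simp: block_mat_def all_ones_mat_def scalar_prod_def atLeast0LessThan\<close>)
  qed
  have "bush_type_hadamard_mat (4 * n\<^sup>2) H"
    unfolding bush_type_hadamard_mat_def hadamard_mat_def
    using H sq el blk off n_pos by (auto simp: N_def)
  with tr show ?thesis by blast
qed

section \<open>Quadratic characters and lines\<close>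

text \<open>If \<open>card S = 2 * k + 1\<close>, give -1 to \<open>k\<close> elements other than
  \<open>s\<close>. Fixing the sign at \<open>s\<close> serves the line whose cosets become the
  blocks.\<close>

lemma exists_signs_sum_1:
  assumes "finite S" "odd (card S)" "s \<in> S"
  shows "\<exists>\<tau>::'x \<Rightarrow> int. (\<forall>i\<in>S. (\<tau> i)\<^sup>2 = 1) \<and> (\<forall>i. i \<notin> S \<longrightarrow> \<tau> i = 0) \<and> \<tau> s = 1 \<and> sum \<tau> S = 1"
proof -
  obtain k where k: "card S = 2 * k + 1" using assms(2) by (elim oddE)
  have "k \<le> card (S - {s})" using k assms by simp
  then obtain U where U: "U \<subseteq> S - {s}" "card U = k" using obtain_subset_with_card_n by metis
  have fU: "finite U" using U assms(1) finite_subset by blast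
  define \<tau> :: "'x \<Rightarrow> int" where "\<tau> i = (if i \<in> U then -1 else if i \<in> S then 1 else 0)" for i
  have "sum \<tau> S = sum \<tau> U + sum \<tau> (S - U)"
    using U assms(1) by (metis Diff_subset Un_Diff_cancel Un_absorb1 subset_trans sum.subset_diff add.commute)
  also have "sum \<tau> U = - int k" using U by (simp add: \<tau>_def)
  also have "sum \<tau> (S - U) = int (card (S - U))" by (simp add: \<tau>_def)
  also have "card (S - U) = card S - card U" using U fU by (intro card_Diff_subset) auto
  finally have "sum \<tau> S = 1" using k U by simp
  then show ?thesis
    using U assms(3) by (intro exI[of _ \<tau>]) (auto simp: \<tau>_def)
qed

text \<open>The finite field is not built as a quotient: the zeros of \<open>\<eta>\<close> form a
  maximal ideal of the ring, and \<open>T\<close> is a system of representatives of its residue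
  classes.\<close>

locale quadratic_residues =
  fixes \<eta> :: "'r::comm_ring_1 \<Rightarrow> int" and T :: "'r set" and q :: nat
  assumes eta_mult: "\<eta> (x * y) = \<eta> x * \<eta> y"
    and eta_values: "\<eta> x \<in> {-1, 0, 1}"
    and eta_cong: "\<eta> (x - y) = 0 \<Longrightarrow> \<eta> x = \<eta> y"
    and eta_1: "\<eta> 1 = 1" and eta_minus_1: "\<eta> (-1) = 1"
    and finite_T: "finite T" and card_T: "card T = q\<^sup>2"
    and representative: "\<exists>t\<in>T. \<eta> (x - t) = 0"
    and representative_unique: "s \<in> T \<Longrightarrow> t \<in> T \<Longrightarrow> \<eta> (s - t) = 0 \<Longrightarrow> s = t"
    and inverse_exists: "\<eta> x \<noteq> 0 \<Longrightarrow> \<exists>y. \<eta> (x * y - 1) = 0"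
    and nonresidue_exists: "\<exists>e. \<eta> e = -1"
    and odd_q: "odd q"
begin

abbreviation Q :: int where "Q \<equiv> (int q)\<^sup>2"

lemma eta_0 [simp]: "\<eta> 0 = 0"
proof -
  obtain t where "\<eta> (0 - t) = 0" using representative by blast
  then show ?thesis using eta_mult[of 0 "0 - t"] by simp
qed

lemma eta_minus [simp]: "\<eta> (- x) = \<eta> x"
  using eta_mult[of "-1" x] eta_minus_1 by simp

lemma eta_diff_commute: "\<eta> (x - y) = \<eta> (y - x)"
  using eta_minus[of "x - y"] by simp

lemma eta_square: "\<eta> x * \<eta> x = of_bool (\<eta> x \<noteq> 0)"
  using eta_values[of x] by auto

lemma eta_mult_eq_0 [simp]: "\<eta> (x * y) = 0 \<longleftrightarrow> \<eta> x = 0 \<or> \<eta> y = 0"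
  by (simp add: eta_mult)

lemma eta_add_zero: "\<eta> x = 0 \<Longrightarrow> \<eta> (x + y) = \<eta> y"
  by (rule eta_cong) simp

definition ind :: "'r \<Rightarrow> int" where "ind x = of_bool (\<eta> x = 0)"

lemma ind_diff_commute: "ind (x - y) = ind (y - x)"
  by (simp add: ind_def eta_diff_commute)

text \<open>These are the functions that descend to the residue field.\<close>

definition periodic :: "('r \<Rightarrow> int) \<Rightarrow> bool" where
  "periodic f \<longleftrightarrow> (\<forall>x y. \<eta> (x - y) = 0 \<longrightarrow> f x = f y)"

lemma eta_affine_cong:
  assumes "\<eta> (x - y) = 0"
  shows "\<eta> (c + k * x) = \<eta> (c + k * y)"
proof (rule eta_cong)
  have "(c + k * x) - (c + k * y) = k * (x - y)" by (simp add: algebra_simps)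
  then show "\<eta> ((c + k * x) - (c + k * y)) = 0" using assms by simp
qed

lemma periodic_eta_affine: "periodic (\<lambda>t. \<eta> (c + k * t))"
  unfolding periodic_def using eta_affine_cong by blast

lemma periodic_ind_affine: "periodic (\<lambda>t. ind (c + k * t))"
  unfolding periodic_def ind_def using eta_affine_cong by metis

lemma periodic_eta: "periodic \<eta>"
  using periodic_eta_affine[of 0 1] by simp

lemma periodic_ind: "periodic ind"
  using periodic_ind_affine[of 0 1] by simp

lemma periodic_mult: "periodic f \<Longrightarrow> periodic g \<Longrightarrow> periodic (\<lambda>t. f t * g t)"
  by (simp add: periodic_def)

text \<open>An affine map with invertible slope permutes the residue classes; \<open>r\<close> is
  the induced permutation of \<open>T\<close>.\<close>

lemma sum_affine:
  assumes "periodic f" "\<eta> k \<noteq> 0"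
  shows "(\<Sum>t\<in>T. f (c + k * t)) = sum f T"
proof -
  define r where "r t = (SOME s. s \<in> T \<and> \<eta> (c + k * t - s) = 0)" for t
  have r: "r t \<in> T \<and> \<eta> (c + k * t - r t) = 0" for t
    unfolding r_def by (rule someI_ex) (use representative in blast)
  have inj: "inj_on r T"
  proof (rule inj_onI)
    fix s t assume st: "s \<in> T" "t \<in> T" "r s = r t"
    have "k * (s - t) = (c + k * s - r s) + - (c + k * t - r t)" using st by (simp add: algebra_simps)
    then have "\<eta> (k * (s - t)) = 0" using r eta_add_zero eta_minus by metis
    then show "s = t" using st assms(2) representative_unique by simp
  qed
  have "r ` T = T"
    using inj r finite_T by (intro endo_inj_surj) auto
  then have "bij_betw r T T" using inj by (simp add: bij_betw_def)
  then have "(\<Sum>t\<in>T. f (r t)) = sum f T" by (rule sum.reindex_bij_betw)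
  moreover have "f (c + k * t) = f (r t)" for t
    using assms(1) r unfolding periodic_def by blast
  ultimately show ?thesis by simp
qed

lemma sum_shift: "periodic f \<Longrightarrow> (\<Sum>t\<in>T. f (t + c)) = sum f T"
  using sum_affine[of f 1 c] by (simp add: eta_1 add.commute)

lemma sum_scale: "periodic f \<Longrightarrow> \<eta> k \<noteq> 0 \<Longrightarrow> (\<Sum>t\<in>T. f (k * t)) = sum f T"
  using sum_affine[of f k 0] by simp

lemma sum_pick:
  assumes "periodic f"
  shows "(\<Sum>t\<in>T. f t * ind (t - c)) = f c"
proof -
  obtain s where s: "s \<in> T" "\<eta> (c - s) = 0" using representative by blast
  have "ind (t - c) = of_bool (t = s)" if "t \<in> T" for t
  proof -
    have "t - s = (c - s) + (t - c)" by simp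
    then have "\<eta> (t - s) = \<eta> (t - c)" using eta_add_zero[OF s(2)] by metis
    then show ?thesis
      using representative_unique[OF that s(1)] by (auto simp: ind_def)
  qed
  then have "(\<Sum>t\<in>T. f t * ind (t - c)) = (\<Sum>t\<in>T. if t = s then f t else 0)"
    by (intro sum.cong) auto
  also have "\<dots> = f s" using s finite_T by simp
  also have "\<dots> = f c" using assms s unfolding periodic_def by metis
  finally show ?thesis .
qed

lemma sum_pick': "periodic f \<Longrightarrow> (\<Sum>t\<in>T. f t * ind (c - t)) = f c"
  using sum_pick[of f c] by (simp add: ind_diff_commute)

lemma sum_ind: "(\<Sum>t\<in>T. ind t) = 1"
  using sum_pick[of "\<lambda>_. 1" 0] by (simp add: periodic_def)

text \<open>Scaling by a nonresidue permutes the classes and negates the sum.\<close>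

lemma sum_eta: "(\<Sum>t\<in>T. \<eta> t) = 0"
proof -
  obtain e where "\<eta> e = -1" using nonresidue_exists by blast
  then show ?thesis using sum_scale[OF periodic_eta, of e] by (simp add: eta_mult sum_negf)
qed

lemma sum_ind_affine: "(\<Sum>t\<in>T. ind (w + k * t)) = (if \<eta> k = 0 then Q * ind w else 1)"
proof (cases "\<eta> k = 0")
  case True
  have "ind (w + k * t) = ind w" for t
    using True eta_add_zero[of "k * t" w] by (simp add: ind_def add.commute)
  then show ?thesis using True by (simp add: card_T)
next
  case False
  then show ?thesis using sum_affine[OF periodic_ind, of k w] sum_ind by simp
qed

text \<open>For invertible \<open>k\<close> only the class of \<open>-w/k\<close> contributes, and
  \<open>\<eta>\<close> takes equal values at \<open>k\<close> and \<open>1/k\<close>.\<close>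

lemma sum_ind_affine_eta: "(\<Sum>t\<in>T. ind (w + k * t) * \<eta> t) = \<eta> k * \<eta> w"
proof (cases "\<eta> k = 0")
  case True
  have "ind (w + k * t) = ind w" for t
    using True eta_add_zero[of "k * t" w] by (simp add: ind_def add.commute)
  then show ?thesis using True by (simp add: sum_distrib_left[symmetric] sum_eta)
next
  case False
  have k: "\<eta> k * \<eta> k = 1" using False by (simp add: eta_square)
  have "(\<Sum>t\<in>T. ind (w + k * t) * \<eta> t) = \<eta> k * (\<Sum>t\<in>T. \<eta> (k * t) * ind ((k * t) - (- w)))"
    unfolding sum_distrib_left
  proof (intro sum.cong refl)
    fix t
    have "\<eta> k * \<eta> (k * t) = \<eta> t"
      using k by (simp add: eta_mult flip: mult.assoc)
    then show "ind (w + k * t) * \<eta> t = \<eta> k * (\<eta> (k * t) * ind (k * t - - w))"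
      by (simp add: add.commute flip: mult.assoc)
  qed
  also have "(\<Sum>t\<in>T. \<eta> (k * t) * ind ((k * t) - (- w))) = (\<Sum>t\<in>T. \<eta> t * ind (t - (- w)))"
    by (rule sum_scale[OF _ False, of "\<lambda>t. \<eta> t * ind (t - (- w))"])
       (use periodic_mult[OF periodic_eta periodic_ind_affine[of w 1]] in \<open>simp add: add.commute\<close>)
  also have "\<dots> = \<eta> w" using sum_pick[OF periodic_eta, of "- w"] by simp
  finally show ?thesis .
qed

lemma periodic_eta_diff: "periodic (\<lambda>t. \<eta> (v - t))"
  using periodic_eta_affine[of v "-1"] by simp

lemma jacobi_sum_scale:
  assumes "\<eta> k \<noteq> 0"
  shows "(\<Sum>t\<in>T. \<eta> (k * v - t) * \<eta> t) = (\<Sum>t\<in>T. \<eta> (v - t) * \<eta> t)"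
proof -
  have k: "\<eta> k * \<eta> k = 1" using assms by (simp add: eta_square)
  have "(\<Sum>t\<in>T. \<eta> (k * v - t) * \<eta> t) = (\<Sum>t\<in>T. \<eta> (k * v - k * t) * \<eta> (k * t))"
    by (rule sum_scale[OF periodic_mult[OF periodic_eta_diff periodic_eta] assms, symmetric])
  also have "\<dots> = (\<Sum>t\<in>T. \<eta> (v - t) * \<eta> t)"
  proof (intro sum.cong refl)
    fix t
    have "\<eta> (k * v - k * t) * \<eta> (k * t) = (\<eta> k * \<eta> k) * (\<eta> (v - t) * \<eta> t)"
      unfolding right_diff_distrib[symmetric] by (simp only: eta_mult mult_ac)
    then show "\<eta> (k * v - k * t) * \<eta> (k * t) = \<eta> (v - t) * \<eta> t" using k by simp
  qed
  finally show ?thesis .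
qed

lemma eta_square_sum: "(\<Sum>t\<in>T. \<eta> t * \<eta> t) = Q - 1"
proof -
  have "\<eta> t * \<eta> t = 1 - ind t" for t by (simp add: eta_square ind_def)
  then show ?thesis using sum_ind by (simp add: sum_subtractf card_T)
qed

text \<open>The values of the Jacobi sum at nonzero arguments agree, and the values at all arguments add up to 0.\<close>

lemma jacobi_sum: "(\<Sum>t\<in>T. \<eta> (v - t) * \<eta> t) = Q * ind v - 1"
proof -
  define J where "J v = (\<Sum>t\<in>T. \<eta> (v - t) * \<eta> t)" for v
  have 0: "J 0 = Q - 1" using eta_square_sum by (simp add: J_def)
  have J: "J v = (if \<eta> v = 0 then Q - 1 else J 1)" for v
  proof (cases "\<eta> v = 0")
    case True
    then have "J v = J 0" unfolding J_def using eta_add_zero[OF True, of "- t" for t] by simp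
    then show ?thesis using 0 True by simp
  next
    case False
    then show ?thesis using jacobi_sum_scale[OF False, of 1] by (simp add: J_def)
  qed
  have "(\<Sum>v\<in>T. J v) = (\<Sum>t\<in>T. (\<Sum>v\<in>T. \<eta> (v + - t)) * \<eta> t)"
    unfolding J_def sum_distrib_right by (subst sum.swap) simp
  also have "\<dots> = 0"
    using sum_shift[OF periodic_eta, of "- t" for t] sum_eta by simp
  finally have "0 = (\<Sum>v\<in>T. (Q - 1 - J 1) * ind v + J 1)"
    by (subst (asm) sum.cong[OF refl, of T J "\<lambda>v. (Q - 1 - J 1) * ind v + J 1"]) (auto simp: J ind_def)
  then have e: "Q - 1 - J 1 + Q * J 1 = 0"
    using sum_ind by (simp add: sum.distrib sum_distrib_left[symmetric] card_T)
  have "(Q - 1) * (J 1 + 1) = 0" using e by (simp add: algebra_simps)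
  moreover have "Q \<noteq> 1"
  proof
    assume "Q = 1"
    then have "card T = 1" by (simp add: card_T flip: of_nat_power)
    then obtain t where t: "T = {t}" by (auto simp: card_1_singleton_iff)
    have "\<eta> (0 - t) = 0" "\<eta> (1 - t) = 0" using representative[of 0] representative[of 1] t by auto
    then have "\<eta> (1::'r) = 0" using eta_add_zero[of "- t" 1] by simp
    then show False using eta_1 by simp
  qed
  ultimately have "J 1 = -1" by simp
  then show ?thesis using J[of v] by (simp add: J_def ind_def)
qed

text \<open>For invertible \<open>k\<close> again only \<open>-w/k\<close> contributes, and the
  factors \<open>\<eta> k\<close> cancel in pairs. Otherwise a Jacobi sum remains.\<close>

lemma sum_ind_affine_eta_eta:
  "(\<Sum>t\<in>T. ind (w + k * t) * (\<eta> (v - t) * \<eta> t)) =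
     (if \<eta> k = 0 then ind w * (Q * ind v - 1) else \<eta> (k * v + w) * \<eta> w)"
proof (cases "\<eta> k = 0")
  case True
  have "ind (w + k * t) = ind w" for t
    using True eta_add_zero[of "k * t" w] by (simp add: ind_def add.commute)
  then show ?thesis using True by (simp add: sum_distrib_left[symmetric] jacobi_sum)
next
  case False
  have k: "\<eta> k * \<eta> k = 1" using False by (simp add: eta_square)
  define g where "g s = (\<eta> (k * v - s) * \<eta> s) * ind (s - (- w))" for s
  have g: "periodic (\<lambda>s. \<eta> (k * v - s) * \<eta> s)"
    by (rule periodic_mult[OF periodic_eta_diff periodic_eta])
  have "(\<Sum>t\<in>T. ind (w + k * t) * (\<eta> (v - t) * \<eta> t)) = (\<Sum>t\<in>T. g (k * t))"
  proof (intro sum.cong refl)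
    fix t
    have "g (k * t) = (\<eta> k * \<eta> k) * ((\<eta> (v - t) * \<eta> t) * ind (k * t - (- w)))"
      unfolding g_def right_diff_distrib[symmetric] by (simp only: eta_mult mult_ac)
    then show "ind (w + k * t) * (\<eta> (v - t) * \<eta> t) = g (k * t)"
      using k by (simp add: add.commute)
  qed
  also have "\<dots> = (\<Sum>s\<in>T. g s)"
    by (rule sum_scale[OF _ False])
       (use periodic_mult[OF g periodic_ind_affine[of w 1]] in \<open>simp add: g_def[abs_def] add.commute\<close>)
  also have "\<dots> = \<eta> (k * v + w) * \<eta> w"
    unfolding g_def using sum_pick[OF g, of "- w"] by simp
  finally show ?thesis using False by simp
qed


text \<open>\<open>None\<close> is the point at infinity of the projective line over the field, and the index \<open>i\<close> stands for the line
  \<open>L i\<close> of the plane spanned by \<open>(0, 1)\<close> or \<open>(1, m)\<close>. Then \<open>line i\<close> is the indicator of \<open>L i\<close>,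
  \<open>sline i\<close> is \<open>\<eta>\<close> of the coordinate along \<open>L i\<close>, and \<open>form i\<close> is \<open>\<eta>\<close> of the determinant with
  the spanning vector.\<close>

fun line :: "'r option \<Rightarrow> 'r \<Rightarrow> 'r \<Rightarrow> int" where
  "line None x y = ind x"
| "line (Some m) x y = ind (y - m * x)"

fun sline :: "'r option \<Rightarrow> 'r \<Rightarrow> 'r \<Rightarrow> int" where
  "sline None x y = ind x * \<eta> y"
| "sline (Some m) x y = ind (y - m * x) * \<eta> x"

fun form :: "'r option \<Rightarrow> 'r \<Rightarrow> 'r \<Rightarrow> int" where
  "form None x y = \<eta> x"
| "form (Some m) x y = \<eta> (y - m * x)"

text \<open>This is \<open>\<eta>\<close> of the determinant of the two spanning vectors, whose
  order is immaterial as \<open>\<eta> (-1) = 1\<close>.\<close>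

fun eps :: "'r option \<Rightarrow> 'r option \<Rightarrow> int" where
  "eps None None = 0"
| "eps None (Some m) = 1"
| "eps (Some m) None = 1"
| "eps (Some m) (Some m') = \<eta> (m - m')"

definition PL :: "'r option set" where "PL = insert None (Some ` T)"

lemma finite_PL: "finite PL"
  by (simp add: PL_def finite_T)

lemma card_PL: "int (card PL) = Q + 1"
  by (simp add: PL_def finite_T card_T card_image)

lemma sum_PL: "sum f PL = f None + (\<Sum>t\<in>T. f (Some t))"
  by (simp add: PL_def finite_T sum.reindex comp_def)

lemma eps_commute: "eps i j = eps j i"
  by (cases i; cases j) (simp_all add: eta_diff_commute)

lemma eps_eq_0_iff: "i \<in> PL \<Longrightarrow> j \<in> PL \<Longrightarrow> eps i j = 0 \<longleftrightarrow> i = j"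
  by (cases i; cases j) (auto simp: PL_def dest: representative_unique)

lemma eta_diff_eq_0_iff: "s \<in> T \<Longrightarrow> t \<in> T \<Longrightarrow> \<eta> (s - t) = 0 \<longleftrightarrow> s = t"
  using representative_unique by auto

section \<open>Convolution algebra of lines and signed lines\<close>

definition conv :: "('r \<Rightarrow> 'r \<Rightarrow> int) \<Rightarrow> ('r \<Rightarrow> 'r \<Rightarrow> int) \<Rightarrow> 'r \<Rightarrow> 'r \<Rightarrow> int" where
  "conv f g x y = (\<Sum>s\<in>T. \<Sum>t\<in>T. f (x - s) (y - t) * g s t)"

lemma sum_pick_mult:
  assumes "periodic f"
  shows "(\<Sum>t\<in>T. f t * (ind (t - c) * a)) = f c * a"
  using sum_pick[OF assms, of c] by (simp flip: mult.assoc sum_distrib_right)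

lemma periodic_ind_diff: "periodic (\<lambda>t. ind (v - t - c))"
  using periodic_ind_affine[of "v - c" "-1"] by (simp add: algebra_simps)

text \<open>A line is a subgroup of order \<open>Q\<close>, and translates of two different lines
  meet in one point.\<close>

lemma conv_line_line:
  assumes "i \<in> PL" "j \<in> PL"
  shows "conv (line i) (line j) x y = (if i = j then Q * line i x y else 1)"
proof (cases i; cases j)
  assume ij: "i = None" "j = None"
  have "conv (line i) (line j) x y = Q * (\<Sum>s\<in>T. ind (x - s) * ind (s - 0))"
    by (simp add: conv_def ij card_T sum_distrib_left)
  then show ?thesis using sum_pick[OF periodic_ind_diff[of x 0], of 0] ij by simp
next
  fix m assume ij: "i = None" "j = Some m"
  have "conv (line i) (line j) x y = (\<Sum>s\<in>T. 1 * ind (x - s))"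
    using sum_pick[of "\<lambda>_. 1"]
    by (simp add: conv_def ij periodic_def sum_distrib_left[symmetric])
  then show ?thesis using sum_pick'[of "\<lambda>_. 1"] ij by (simp add: periodic_def)
next
  fix m assume ij: "i = Some m" "j = None"
  have "conv (line i) (line j) x y = (\<Sum>s\<in>T. (\<Sum>t\<in>T. 1 * ind (y - m * (x - s) - t)) * ind s)"
    unfolding conv_def ij line.simps sum_distrib_right
    by (intro sum.cong refl) (simp add: algebra_simps)
  also have "\<dots> = 1" using sum_pick'[of "\<lambda>_. 1"] sum_ind by (simp add: periodic_def)
  finally show ?thesis using ij by simp
next
  fix m m' assume ij: "i = Some m" "j = Some m'"
  have "conv (line i) (line j) x y = (\<Sum>s\<in>T. ind ((y - m * x) + (m - m') * s))"
    unfolding conv_def ij line.simps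
    by (subst sum_pick[OF periodic_ind_diff]) (simp add: algebra_simps)
  then show ?thesis
    using ij assms by (auto simp: sum_ind_affine eta_diff_eq_0_iff PL_def)
qed

text \<open>The value is the sum of \<open>\<eta>\<close> over the part of line \<open>j\<close> in
  a coset of line \<open>i\<close>. For distinct lines this is one point, whose coordinate is a
  quotient of two determinants; for equal lines it is empty or the whole line, with sum 0.\<close>

lemma conv_line_sline:
  shows "conv (line i) (sline j) x y = eps i j * form i x y"
proof (cases i; cases j)
  assume ij: "i = None" "j = None"
  show ?thesis
    by (simp add: conv_def ij sum_distrib_left[symmetric] sum_eta)
next
  fix m assume ij: "i = None" "j = Some m"
  have "conv (line i) (sline j) x y = (\<Sum>s\<in>T. \<eta> s * ind (x - s) * (\<Sum>t\<in>T. 1 * ind (t - m * s)))"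
    by (simp add: conv_def ij sum_distrib_left mult_ac)
  then show ?thesis
    using sum_pick[of "\<lambda>_. 1"] sum_pick'[OF periodic_eta] ij by (simp add: periodic_def)
next
  fix m assume ij: "i = Some m" "j = None"
  have "conv (line i) (sline j) x y = (\<Sum>t\<in>T. \<eta> t * (\<Sum>s\<in>T. ind ((y - t) - m * (x - s)) * ind (s - 0)))"
    unfolding conv_def ij line.simps sline.simps
    by (subst sum.swap) (simp add: sum_distrib_left mult_ac)
  also have "\<dots> = (\<Sum>t\<in>T. \<eta> t * ind ((y - t) - m * (x - 0)))"
  proof (intro sum.cong refl arg_cong2[where f = "(*)"])
    fix t
    have "periodic (\<lambda>s. ind ((y - t) - m * (x - s)))"
      using periodic_ind_affine[of "y - t - m * x" m] by (simp add: algebra_simps)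
    then show "(\<Sum>s\<in>T. ind ((y - t) - m * (x - s)) * ind (s - 0)) = ind ((y - t) - m * (x - 0))"
      by (rule sum_pick)
  qed
  also have "\<dots> = \<eta> (y - m * x)"
    using sum_pick'[OF periodic_eta, of "y - m * x"] by (simp add: algebra_simps)
  finally show ?thesis using ij by simp
next
  fix m m' assume ij: "i = Some m" "j = Some m'"
  have "conv (line i) (sline j) x y = (\<Sum>s\<in>T. ind ((y - m * x) + (m - m') * s) * \<eta> s)"
    unfolding conv_def ij line.simps sline.simps
    by (subst sum_pick_mult[OF periodic_ind_diff]) (simp add: algebra_simps)
  then show ?thesis
    using ij by (simp add: sum_ind_affine_eta)
qed

text \<open>For distinct lines a point splits uniquely into components, whose coordinates are given
  by Cramer's rule; the common denominator enters twice and drops out. For equal lines this is a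
  Jacobi sum along the line.\<close>

lemma conv_sline_sline:
  assumes "i \<in> PL" "j \<in> PL"
  shows "conv (sline i) (sline j) x y =
    form i x y * form j x y + of_bool (i = j) * (Q * (ind x * ind y) - 1)"
proof (cases i; cases j)
  assume ij: "i = None" "j = None"
  have "conv (sline i) (sline j) x y = (\<Sum>s\<in>T. ind (x - s) * ind (s - 0)) * (\<Sum>t\<in>T. \<eta> (y - t) * \<eta> t)"
    unfolding conv_def ij sline.simps sum_product
    by (intro sum.cong refl) (simp add: mult_ac)
  also have "\<dots> = ind x * (Q * ind y - 1)"
    using sum_pick[OF periodic_ind_diff[of x 0], of 0] jacobi_sum by simp
  finally show ?thesis using ij by (simp add: eta_square ind_def)
next
  fix m assume ij: "i = None" "j = Some m"
  have "conv (sline i) (sline j) x y = (\<Sum>s\<in>T. \<eta> s * ind (x - s) * (\<Sum>t\<in>T. \<eta> (y - t) * ind (t - m * s)))"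
    by (simp add: conv_def ij sum_distrib_left mult_ac)
  also have "\<dots> = (\<Sum>s\<in>T. (\<eta> s * \<eta> (y - m * s)) * ind (x - s))"
    by (simp add: sum_pick[OF periodic_eta_diff] mult_ac)
  also have "\<dots> = \<eta> x * \<eta> (y - m * x)"
    by (rule sum_pick') (use periodic_mult[OF periodic_eta periodic_eta_affine[of y "-m"]] in simp)
  finally show ?thesis using ij by simp
next
  fix m assume ij: "i = Some m" "j = None"
  have "conv (sline i) (sline j) x y =
      (\<Sum>t\<in>T. \<eta> t * (\<Sum>s\<in>T. (ind ((y - t) - m * (x - s)) * \<eta> (x - s)) * ind (s - 0)))"
    unfolding conv_def ij sline.simps
    by (subst sum.swap) (simp add: sum_distrib_left mult_ac)
  also have "\<dots> = (\<Sum>t\<in>T. \<eta> t * (ind ((y - t) - m * (x - 0)) * \<eta> (x - 0)))"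
  proof (intro sum.cong refl arg_cong2[where f = "(*)"])
    fix t
    have "periodic (\<lambda>s. ind ((y - t) - m * (x - s)))"
      using periodic_ind_affine[of "y - t - m * x" m] by (simp add: algebra_simps)
    then have "periodic (\<lambda>s. ind ((y - t) - m * (x - s)) * \<eta> (x - s))"
      by (rule periodic_mult[OF _ periodic_eta_diff])
    then show "(\<Sum>s\<in>T. (ind ((y - t) - m * (x - s)) * \<eta> (x - s)) * ind (s - 0)) =
        ind ((y - t) - m * (x - 0)) * \<eta> (x - 0)"
      by (rule sum_pick)
  qed
  also have "\<dots> = (\<Sum>t\<in>T. \<eta> t * ind ((y - m * x) - t)) * \<eta> x"
    unfolding sum_distrib_right by (simp add: algebra_simps)
  also have "\<dots> = \<eta> (y - m * x) * \<eta> x"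
    by (simp add: sum_pick'[OF periodic_eta])
  finally show ?thesis using ij by simp
next
  fix m m' assume ij: "i = Some m" "j = Some m'"
  have "conv (sline i) (sline j) x y =
      (\<Sum>s\<in>T. \<Sum>t\<in>T. ind (y - t - m * (x - s)) * (ind (t - m' * s) * (\<eta> (x - s) * \<eta> s)))"
    by (simp add: conv_def ij mult_ac)
  also have "\<dots> = (\<Sum>s\<in>T. ind ((y - m * x) + (m - m') * s) * (\<eta> (x - s) * \<eta> s))"
    by (subst sum_pick_mult[OF periodic_ind_diff]) (simp add: algebra_simps)
  also have "\<dots> = (if \<eta> (m - m') = 0 then ind (y - m * x) * (Q * ind x - 1)
      else \<eta> ((m - m') * x + (y - m * x)) * \<eta> (y - m * x))"
    by (rule sum_ind_affine_eta_eta)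
  also have "(m - m') * x + (y - m * x) = y - m' * x" by (simp add: algebra_simps)
  finally have c: "conv (sline i) (sline j) x y = (if \<eta> (m - m') = 0 then ind (y - m * x) * (Q * ind x - 1)
      else \<eta> (y - m' * x) * \<eta> (y - m * x))" .
  show ?thesis
  proof (cases "m = m'")
    case True
    have "ind (y - m * x) * ind x = ind x * ind y"
    proof (cases "\<eta> x = 0")
      case True
      then show ?thesis using eta_add_zero[of "- (m * x)" y] by (simp add: ind_def)
    qed (simp add: ind_def)
    then have "ind (y - m * x) * (Q * ind x - 1) = Q * (ind x * ind y) - ind (y - m * x)"
      by (auto simp: algebra_simps)
    then show ?thesis using True ij c by (simp add: eta_square ind_def)
  next
    case False
    then show ?thesis using ij c assms by (auto simp: PL_def eta_diff_eq_0_iff)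
  qed
qed

text \<open>A nonzero point is \<open>r\<close> times the spanning vector of a unique line
  \<open>j\<close>. Take \<open>c = \<eta> r\<close> and pull \<open>r\<close> out of the
  determinants.\<close>

lemma point_on_line:
  assumes "\<not> (\<eta> x = 0 \<and> \<eta> y = 0)"
  shows "\<exists>j\<in>PL. \<exists>c\<in>{1, -1}. \<forall>i\<in>PL. line i x y = of_bool (i = j) \<and>
    sline i x y = c * of_bool (i = j) \<and> form i x y = c * eps i j"
proof -
  have *: ?thesis if j: "j \<in> PL" and c: "c \<in> {1, -1}"
    and form: "\<And>i. i \<in> PL \<Longrightarrow> form i x y = c * eps i j" and s: "line j x y = 1 \<Longrightarrow> sline j x y = c" for j c
  proof (intro bexI[OF _ j] bexI[OF _ c] ballI)
    fix i assume i: "i \<in> PL"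
    have "line i x y = of_bool (form i x y = 0)" by (cases i) (simp_all add: ind_def)
    then have l: "line i x y = of_bool (i = j)"
      using eps_eq_0_iff[OF i j] form[OF i] c by auto
    have "line i x y = 0 \<Longrightarrow> sline i x y = 0" by (cases i) simp_all
    then have "sline i x y = c * of_bool (i = j)" using l s by (cases "i = j") auto
    with l form[OF i]
    show "line i x y = of_bool (i = j) \<and> sline i x y = c * of_bool (i = j) \<and> form i x y = c * eps i j"
      by simp
  qed
  show ?thesis
  proof (cases "\<eta> x = 0")
    case True
    have "form i x y = \<eta> y * eps i None" for i
      using True eta_add_zero[of "- (m * x)" y for m] by (cases i) simp_all
    then show ?thesis
      using assms True eta_values[of y] by (intro *[of None "\<eta> y"]) (auto simp: PL_def ind_def)
  next
    case False
    then obtain x' where x': "\<eta> (x * x' - 1) = 0" using inverse_exists by blast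
    obtain m where m: "m \<in> T" "\<eta> (y * x' - m) = 0" using representative by blast
    have "y - m * x = - (y * (x * x' - 1)) + x * (y * x' - m)" by (simp add: algebra_simps)
    then have y: "\<eta> (y - m * x) = 0" using m x' eta_add_zero[of "- (y * (x * x' - 1))"] by simp
    have "form i x y = \<eta> x * eps i (Some m)" for i
    proof (cases i)
      case (Some m')
      have "y - m' * x = (y - m * x) + x * (m - m')" by (simp add: algebra_simps)
      then have "\<eta> (y - m' * x) = \<eta> (x * (m - m'))" using eta_add_zero[OF y] by metis
      then show ?thesis using Some eta_diff_commute[of m m'] by (simp add: eta_mult)
    qed simp
    then show ?thesis
      using False m eta_values[of x] by (intro *[of "Some m" "\<eta> x"]) (auto simp: PL_def)
  qed
qed

lemma conv_sum:
  "conv (\<lambda>x y. \<Sum>i\<in>I. c i * f i x y) (\<lambda>x y. \<Sum>j\<in>J. d j * g j x y) x y =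
    (\<Sum>i\<in>I. \<Sum>j\<in>J. c i * d j * conv (f i) (g j) x y)"
proof -
  have "conv (\<lambda>x y. \<Sum>i\<in>I. c i * f i x y) (\<lambda>x y. \<Sum>j\<in>J. d j * g j x y) x y =
      (\<Sum>p\<in>T \<times> T. (\<Sum>i\<in>I. c i * f i (x - fst p) (y - snd p)) * (\<Sum>j\<in>J. d j * g j (fst p) (snd p)))"
    by (simp add: conv_def sum.cartesian_product case_prod_unfold)
  also have "\<dots> = (\<Sum>p\<in>T \<times> T. \<Sum>k\<in>I \<times> J. c (fst k) * d (snd k) *
        (f (fst k) (x - fst p) (y - snd p) * g (snd k) (fst p) (snd p)))"
    unfolding sum_product sum.cartesian_product
    by (intro sum.cong refl) (simp add: case_prod_unfold mult_ac)
  also have "\<dots> = (\<Sum>k\<in>I \<times> J. c (fst k) * d (snd k) *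
        (\<Sum>p\<in>T \<times> T. f (fst k) (x - fst p) (y - snd p) * g (snd k) (fst p) (snd p)))"
    by (subst sum.swap) (simp add: sum_distrib_left)
  also have "\<dots> = (\<Sum>i\<in>I. \<Sum>j\<in>J. c i * d j * conv (f i) (g j) x y)"
    by (simp add: conv_def sum.cartesian_product case_prod_unfold)
  finally show ?thesis .
qed


text \<open>The first product vanishes because \<open>\<tau>\<close> lives on \<open>S\<close> and
  the image of \<open>u\<close> under \<open>eps\<close> off \<open>S\<close>. In the second,
  distinct lines contribute the square of \<open>sum \<tau> PL\<close>, which is 1, and the square
  of the sum of forms. A nonzero point of line \<open>j\<close> gets
  \<open>1 + Q - 2 * card S = 0\<close>, whether or not \<open>j\<close> is in \<open>S\<close>; the
  origin gets \<open>1 + (Q + 1) * (Q - 1)\<close>.\<close>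

lemma half_plane_square:
  assumes S: "S \<subseteq> PL" "2 * int (card S) = Q + 1"
    and \<tau>: "\<And>i. i \<in> PL \<Longrightarrow> (\<tau> i)\<^sup>2 = of_bool (i \<in> S)" "sum \<tau> PL = 1"
    and u: "\<And>i. i \<in> PL \<Longrightarrow> (u i)\<^sup>2 = of_bool (i \<in> S)"
    and eig: "\<And>i. i \<in> PL \<Longrightarrow> (\<Sum>j\<in>PL. eps i j * u j)\<^sup>2 = Q * of_bool (i \<notin> S)"
  defines "f \<equiv> \<lambda>x y. \<Sum>i\<in>PL. \<tau> i * line i x y" and "g \<equiv> \<lambda>x y. \<Sum>i\<in>PL. u i * sline i x y"
  shows "conv f g x y = 0"
    and "conv f f x y + conv g g x y = Q\<^sup>2 * (ind x * ind y)"
proof -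
  have z: "\<tau> i * (\<Sum>j\<in>PL. eps i j * u j) = 0" if "i \<in> PL" for i
    using \<tau>(1)[OF that] eig[OF that] by (cases "i \<in> S") auto
  have "conv f g x y = (\<Sum>i\<in>PL. (\<tau> i * (\<Sum>j\<in>PL. eps i j * u j)) * form i x y)"
    unfolding f_def g_def conv_sum conv_line_sline sum_distrib_left sum_distrib_right
    by (intro sum.cong refl) (simp add: mult_ac)
  then show "conv f g x y = 0" using z by simp
  have pull: "(\<Sum>i\<in>PL. \<Sum>j\<in>PL. of_bool (i = j) * h i j) = (\<Sum>i\<in>PL. h i i)" for h :: "_ \<Rightarrow> _ \<Rightarrow> int"
  proof (intro sum.cong refl)
    fix i assume "i \<in> PL"
    have "(\<Sum>j\<in>PL. of_bool (i = j) * h i j) = (\<Sum>j\<in>PL. if i = j then h i j else 0)"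
      by (intro sum.cong) auto
    then show "(\<Sum>j\<in>PL. of_bool (i = j) * h i j) = h i i"
      using \<open>i \<in> PL\<close> finite_PL by simp
  qed
  have onS: "(\<Sum>i\<in>PL. of_bool (i \<in> S) * h i) = sum h S" for h :: "_ \<Rightarrow> int"
  proof -
    have "(\<Sum>i\<in>PL. of_bool (i \<in> S) * h i) = (\<Sum>i\<in>PL. if i \<in> S then h i else 0)"
      by (intro sum.cong) auto
    then show ?thesis using S(1) finite_PL by (simp add: sum.If_cases Int_absorb1)
  qed
  have "conv f f x y = (\<Sum>i\<in>PL. \<Sum>j\<in>PL. \<tau> i * \<tau> j + of_bool (i = j) * (\<tau> i * \<tau> j * (Q * line i x y - 1)))"
    unfolding f_def conv_sum by (intro sum.cong refl) (auto simp: conv_line_line algebra_simps)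
  also have "\<dots> = (sum \<tau> PL)\<^sup>2 + (\<Sum>i\<in>PL. of_bool (i \<in> S) * (Q * line i x y - 1))"
    unfolding sum.distrib pull power2_eq_square[of "sum \<tau> PL"] sum_product
    by (simp add: \<tau>(1) flip: power2_eq_square)
  finally have ff: "conv f f x y = 1 + (\<Sum>i\<in>S. Q * line i x y - 1)"
    unfolding onS \<tau>(2) by simp
  have "conv g g x y = (\<Sum>i\<in>PL. \<Sum>j\<in>PL. (u i * form i x y) * (u j * form j x y) +
      of_bool (i = j) * (u i * u j * (Q * (ind x * ind y) - 1)))"
    unfolding g_def conv_sum by (intro sum.cong refl) (auto simp: conv_sline_sline algebra_simps)
  also have "\<dots> = (\<Sum>i\<in>PL. u i * form i x y)\<^sup>2 + (\<Sum>i\<in>PL. of_bool (i \<in> S) * (Q * (ind x * ind y) - 1))"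
    unfolding sum.distrib pull power2_eq_square[of "sum _ PL"] sum_product
    by (simp add: u flip: power2_eq_square)
  finally have gg: "conv g g x y = (\<Sum>i\<in>PL. u i * form i x y)\<^sup>2 + int (card S) * (Q * (ind x * ind y) - 1)"
    unfolding onS by simp
  show "conv f f x y + conv g g x y = Q\<^sup>2 * (ind x * ind y)"
  proof (cases "\<eta> x = 0 \<and> \<eta> y = 0")
    case True
    have "\<eta> (y - m * x) = 0" for m
      using True eta_add_zero[of "- (m * x)" y] by simp
    then have l: "line i x y = 1" "form i x y = 0" for i
      using True by (cases i; simp add: ind_def)+
    have "conv f f x y + conv g g x y = 1 + 2 * int (card S) * (Q - 1)"
      unfolding ff gg l using True by (simp add: ind_def algebra_simps)
    also have "\<dots> = Q\<^sup>2" unfolding S(2) by (simp add: algebra_simps power2_eq_square)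
    finally show ?thesis using True by (simp add: ind_def)
  next
    case False
    obtain j c where j: "j \<in> PL" and c: "c \<in> {1, -1}"
      and jc: "\<And>i. i \<in> PL \<Longrightarrow> line i x y = of_bool (i = j) \<and> form i x y = c * eps i j"
      using point_on_line[OF False] by blast
    have "(\<Sum>i\<in>S. line i x y) = (\<Sum>i\<in>S. of_bool (i = j))"
      using jc S(1) by (intro sum.cong refl) auto
    also have "\<dots> = of_bool (j \<in> S)"
      using finite_subset[OF S(1) finite_PL] by (simp add: of_bool_def)
    finally have 1: "conv f f x y = 1 + Q * of_bool (j \<in> S) - int (card S)"
      unfolding ff by (simp add: sum_subtractf flip: sum_distrib_left)
    have "(\<Sum>i\<in>PL. u i * form i x y) = c * (\<Sum>i\<in>PL. eps j i * u i)"
      unfolding sum_distrib_left by (intro sum.cong refl) (simp add: jc eps_commute[of j])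
    then have "(\<Sum>i\<in>PL. u i * form i x y)\<^sup>2 = Q * of_bool (j \<notin> S)"
      using c eig[OF j] by (auto simp: power_mult_distrib)
    then have "conv g g x y = Q * of_bool (j \<notin> S) - int (card S)"
      unfolding gg using False by (auto simp: ind_def)
    with 1 S(2) False show ?thesis by (auto simp: ind_def)
  qed
qed

section \<open>From functions on the plane to seeds\<close>

definition periodic2 :: "('r \<Rightarrow> 'r \<Rightarrow> int) \<Rightarrow> bool" where
  "periodic2 f \<longleftrightarrow> (\<forall>x y x' y'. \<eta> (x - x') = 0 \<longrightarrow> \<eta> (y - y') = 0 \<longrightarrow> f x y = f x' y')"

lemma periodic2_line: "periodic2 (line i)" and periodic2_sline: "periodic2 (sline i)"
proof -
  have d: "\<eta> (y - m * x) = \<eta> (y' - m * x')" if "\<eta> (x - x') = 0" "\<eta> (y - y') = 0" for x y x' y' m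
  proof (rule eta_cong)
    have "(y - m * x) - (y' - m * x') = (y - y') + - (m * (x - x'))" by (simp add: algebra_simps)
    moreover have "\<eta> ((y - y') + - (m * (x - x'))) = 0"
      using that by (simp only: eta_add_zero eta_minus eta_mult_eq_0 simp_thms)
    ultimately show "\<eta> ((y - m * x) - (y' - m * x')) = 0" by (simp only:)
  qed
  have "line i x y = line i x' y'" "sline i x y = sline i x' y'"
    if "\<eta> (x - x') = 0" "\<eta> (y - y') = 0" for x y x' y'
    using d[OF that] eta_cong[OF that(1)] eta_cong[OF that(2)] by (cases i; simp add: ind_def)+
  then show "periodic2 (line i)" "periodic2 (sline i)"
    unfolding periodic2_def by blast+
qed

lemma periodic2_sum: "(\<And>i. periodic2 (f i)) \<Longrightarrow> periodic2 (\<lambda>x y. \<Sum>i\<in>I. c i * f i x y)"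
  unfolding periodic2_def by (intro allI impI sum.cong refl) metis

text \<open>Matrices that depend only on the difference of the indices multiply by
  convolution.\<close>

lemma sum_conv:
  assumes "periodic2 f" "periodic2 g"
  shows "(\<Sum>p\<in>T \<times> T. f (x - fst p) (y - snd p) * g (fst p - z) (snd p - w)) = conv f g (x - z) (y - w)"
proof -
  have p: "periodic (\<lambda>t. f (x - s) (y - t) * g (s - z) (t - w))" for s
    using assms unfolding periodic_def periodic2_def
    by (auto intro!: arg_cong2[where f = "(*)"] simp: eta_diff_commute)
  have p': "periodic (\<lambda>s. f (x - s) (v - t) * g (s - z) t)" for v t
    using assms unfolding periodic_def periodic2_def
    by (auto intro!: arg_cong2[where f = "(*)"] simp: eta_diff_commute)
  have "(\<Sum>p\<in>T \<times> T. f (x - fst p) (y - snd p) * g (fst p - z) (snd p - w)) =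
      (\<Sum>s\<in>T. \<Sum>t\<in>T. f (x - s) (y - t) * g (s - z) (t - w))"
    by (simp add: sum.cartesian_product case_prod_unfold)
  also have "\<dots> = (\<Sum>s\<in>T. \<Sum>t\<in>T. f (x - s) (y - w - t) * g (s - z) t)"
    using sum_shift[OF p, of _ w] by (simp add: algebra_simps)
  also have "\<dots> = (\<Sum>t\<in>T. \<Sum>s\<in>T. f (x - s) (y - w - t) * g (s - z) t)"
    by (rule sum.swap)
  also have "\<dots> = (\<Sum>t\<in>T. \<Sum>s\<in>T. f (x - z - s) (y - w - t) * g s t)"
  proof (rule sum.cong[OF refl])
    fix t
    show "(\<Sum>s\<in>T. f (x - s) (y - w - t) * g (s - z) t) = (\<Sum>s\<in>T. f (x - z - s) (y - w - t) * g s t)"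
      using sum_shift[OF p'[of "y - w" t], of z] by (simp add: algebra_simps)
  qed
  also have "\<dots> = conv f g (x - z) (y - w)"
    unfolding conv_def by (rule sum.swap)
  finally show ?thesis .
qed

lemma line_even: "line i (- x) (- y) = line i x y"
  and sline_even: "sline i (- x) (- y) = sline i x y"
proof -
  have "\<eta> (m * x - y) = \<eta> (y - m * x)" for m by (rule eta_diff_commute)
  then show "line i (- x) (- y) = line i x y" "sline i (- x) (- y) = sline i x y"
    by (cases i; simp add: ind_def)+
qed


lemma orth_pair_conv:
  assumes per: "periodic2 f" "periodic2 g"
    and even: "\<And>x y. f (- x) (- y) = f x y" "\<And>x y. g (- x) (- y) = g x y"
    and fg: "\<And>x y. conv f g x y = 0"
    and sq: "\<And>x y. conv f f x y + conv g g x y = Q\<^sup>2 * (ind x * ind y)"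
  shows "orth_pair (T \<times> T) (q\<^sup>2) (\<lambda>t x y. (if t then g else f) (fst x - fst y) (snd x - snd y))"
proof -
  have ef: "f (x - y) (z - w) = f (y - x) (w - z)" "g (x - y) (z - w) = g (y - x) (w - z)" for x y z w
    using even(1)[of "x - y" "z - w"] even(2)[of "x - y" "z - w"] by simp_all
  have fg0: "(\<Sum>y\<in>T \<times> T. f (fst x - fst y) (snd x - snd y) * g (fst y - fst z) (snd y - snd z)) = 0" for x z
    by (simp add: sum_conv[OF per] fg)
  show ?thesis
    unfolding orth_pair_def
  proof (intro conjI ballI allI)
    show "(if t then g else f) (fst x - fst y) (snd x - snd y) = (if t then g else f) (fst y - fst x) (snd y - snd x)"
      for t and x y :: "'r \<times> 'r"
      using ef by simp
    show "(\<Sum>y\<in>T \<times> T. (if t then g else f) (fst x - fst y) (snd x - snd y) *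
        (if \<not> t then g else f) (fst y - fst z) (snd y - snd z)) = 0" for t and x z :: "'r \<times> 'r"
    proof (cases t)
      case False
      then show ?thesis using fg0 by simp
    next
      case True
      \<comment> \<open>Both matrices are symmetric, so this is the transpose of the product known
        to vanish.\<close>
      have "(\<Sum>y\<in>T \<times> T. g (fst x - fst y) (snd x - snd y) * f (fst y - fst z) (snd y - snd z)) =
          (\<Sum>y\<in>T \<times> T. f (fst z - fst y) (snd z - snd y) * g (fst y - fst x) (snd y - snd x))"
        by (intro sum.cong refl) (metis ef mult.commute)
      then show ?thesis using True fg0 by simp
    qed
    fix x z assume "x \<in> T \<times> T" "z \<in> T \<times> T"
    then have "x = z \<longleftrightarrow> \<eta> (fst x - fst z) = 0 \<and> \<eta> (snd x - snd z) = 0"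
      by (auto simp: prod_eq_iff intro: representative_unique)
    then show "(\<Sum>y\<in>T \<times> T. (if False then g else f) (fst x - fst y) (snd x - snd y) *
          (if False then g else f) (fst y - fst z) (snd y - snd z)) +
        (\<Sum>y\<in>T \<times> T. (if True then g else f) (fst x - fst y) (snd x - snd y) *
          (if True then g else f) (fst y - fst z) (snd y - snd z)) = (int (q\<^sup>2))\<^sup>2 * of_bool (x = z)"
      by (simp add: sum_conv per sq ind_def)
  qed
qed

text \<open>The blocks will be the cosets of the vertical line \<open>None\<close>; this and the
  next lemma sum over one such coset.\<close>

lemma sum_line_block: "(\<Sum>t\<in>T. line i x (y - t)) = (if i = None then Q * ind x else 1)"
proof (cases i)
  case (Some m)
  have "(\<Sum>t\<in>T. line i x (y - t)) = (\<Sum>t\<in>T. 1 * ind ((y - m * x) - t))"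
    by (simp add: Some algebra_simps)
  then show ?thesis using sum_pick'[of "\<lambda>_. 1"] Some by (simp add: periodic_def)
qed (simp add: card_T)

lemma sum_sline_block: "(\<Sum>t\<in>T. sline i x (y - t)) = \<eta> x * eps None i"
proof (cases i)
  case None
  then show ?thesis
    using sum_affine[OF periodic_eta, of "-1" y] by (simp add: eta_1 sum_eta flip: sum_distrib_left)
next
  case (Some m)
  have "(\<Sum>t\<in>T. sline i x (y - t)) = (\<Sum>t\<in>T. \<eta> x * ind ((y - m * x) - t))"
    by (simp add: Some algebra_simps)
  then show ?thesis using sum_pick'[of "\<lambda>_. \<eta> x"] Some by (simp add: periodic_def)
qed

text \<open>If \<open>v\<close> and \<open>w\<close> are \<open>\<plusminus>1\<close> eigenvectors of \<open>eps\<close> for the eigenvalues \<open>q\<close> and \<open>-q\<close>, then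
  \<open>(v + w) / 2\<close> and \<open>(v - w) / 2\<close> have complementary supports of equal size, and \<open>eps\<close> maps each of them to
  \<open>q\<close> times the other.\<close>

lemma bush_seed_exists:
  fixes v w :: "'r option \<Rightarrow> int"
  assumes v: "\<And>i. i \<in> PL \<Longrightarrow> v i \<in> {1, -1}" and w: "\<And>i. i \<in> PL \<Longrightarrow> w i \<in> {1, -1}"
    and eig_v: "\<And>i. i \<in> PL \<Longrightarrow> (\<Sum>j\<in>PL. eps i j * v j) = int q * v i"
    and eig_w: "\<And>i. i \<in> PL \<Longrightarrow> (\<Sum>j\<in>PL. eps i j * w j) = - int q * w i"
    and "v None = w None"
  shows "\<exists>a b. bush_seed T T (q\<^sup>2) a b"
proof -
  define S where "S = {i \<in> PL. v i = w i}"
  define S' where "S' = {i \<in> PL. v i \<noteq> w i}"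
  define u where "u i = (if i \<in> S then v i else 0)" for i
  define u' where "u' i = (if i \<in> S' then v i else 0)" for i
  have q: "q > 0" using odd_q by (rule odd_pos)
  have SS: "S \<subseteq> PL" "S' \<subseteq> PL" "S \<union> S' = PL" "S \<inter> S' = {}" by (auto simp: S_def S'_def)
  have S'_iff: "i \<in> S' \<longleftrightarrow> i \<notin> S" if "i \<in> PL" for i using that by (auto simp: S_def S'_def)
  have fin: "finite S" "finite S'" using SS finite_PL finite_subset by blast+
  have uv: "2 * u i = v i + w i" "2 * u' i = v i - w i" if "i \<in> PL" for i
    using v[OF that] w[OF that] that by (auto simp: u_def u'_def S_def S'_def)

  have eu: "(\<Sum>j\<in>PL. eps i j * u j) = int q * u' i" "(\<Sum>j\<in>PL. eps i j * u' j) = int q * u i" if i: "i \<in> PL" for i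
  proof -
    have "2 * (\<Sum>j\<in>PL. eps i j * u j) = (\<Sum>j\<in>PL. eps i j * v j) + (\<Sum>j\<in>PL. eps i j * w j)"
      unfolding sum_distrib_left sum.distrib[symmetric]
      by (intro sum.cong refl) (metis uv(1) distrib_left mult.left_commute)
    also have "\<dots> = int q * (v i - w i)" unfolding eig_v[OF i] eig_w[OF i] by (simp add: algebra_simps)
    finally show "(\<Sum>j\<in>PL. eps i j * u j) = int q * u' i" using uv(2)[OF i, symmetric] by simp
    have "2 * (\<Sum>j\<in>PL. eps i j * u' j) = (\<Sum>j\<in>PL. eps i j * v j) - (\<Sum>j\<in>PL. eps i j * w j)"
      unfolding sum_distrib_left sum_subtractf[symmetric]
      by (intro sum.cong refl) (metis uv(2) right_diff_distrib mult.left_commute)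
    also have "\<dots> = int q * (v i + w i)" unfolding eig_v[OF i] eig_w[OF i] by (simp add: algebra_simps)
    finally show "(\<Sum>j\<in>PL. eps i j * u' j) = int q * u i" using uv(1)[OF i, symmetric] by simp
  qed

  \<comment> \<open>Eigenvectors of a symmetric matrix for different eigenvalues are orthogonal, so
    \<open>v\<close> and \<open>w\<close> agree as often as they differ.\<close>
  have "int q * (\<Sum>i\<in>PL. v i * w i) = (\<Sum>i\<in>PL. (\<Sum>j\<in>PL. eps i j * v j) * w i)"
    unfolding sum_distrib_left by (intro sum.cong refl) (simp add: eig_v)
  also have "\<dots> = (\<Sum>j\<in>PL. \<Sum>i\<in>PL. eps i j * v j * w i)"
    unfolding sum_distrib_right by (rule sum.swap)
  also have "\<dots> = (\<Sum>j\<in>PL. (\<Sum>i\<in>PL. eps j i * w i) * v j)"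
    unfolding sum_distrib_right by (intro sum.cong refl) (simp add: eps_commute mult_ac)
  also have "\<dots> = - int q * (\<Sum>i\<in>PL. v i * w i)"
    unfolding sum_distrib_left by (intro sum.cong refl) (simp add: eig_w)
  finally have vw0: "(\<Sum>i\<in>PL. v i * w i) = 0" using q by simp
  have "(\<Sum>i\<in>PL. v i * w i) = (\<Sum>i\<in>S. v i * w i) + (\<Sum>i\<in>S'. v i * w i)"
    using SS fin by (metis sum.union_disjoint)
  also have "(\<Sum>i\<in>S. v i * w i) = (\<Sum>i\<in>S. 1)"
    using v w by (intro sum.cong refl) (force simp: S_def)
  also have "(\<Sum>i\<in>S'. v i * w i) = (\<Sum>i\<in>S'. -1)"
    using v w by (intro sum.cong refl) (force simp: S'_def)
  finally have eq: "card S = card S'" using vw0 by simp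
  have "card PL = card S + card S'" using SS fin by (metis card_Un_disjoint)
  then have cS: "2 * int (card S) = Q + 1" "2 * int (card S') = Q + 1" using eq card_PL by auto
  \<comment> \<open>An odd square is 1 modulo 4, so half of \<open>Q + 1\<close> is odd, as signs
    with sum 1 require.\<close>
  have odd_S: "odd (card S)"
  proof
    assume "even (card S)"
    then obtain k where "card S = 2 * k" by (elim evenE)
    then have "4 * int k = Q + 1" using cS by simp
    moreover obtain l where "q = 2 * l + 1" using odd_q by (elim oddE)
    ultimately have "4 * int k = 4 * (int l * int l + int l) + 2" by (simp add: power2_eq_square algebra_simps)
    then show False by presburger
  qed
  have Q: "Q > 0" using q by simp
  then have "card S' \<noteq> 0" using cS(2) by linarith
  then obtain s' where s': "s' \<in> S'" by fastforce
  have None: "None \<in> S" using assms(5) by (simp add: S_def PL_def)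
  obtain \<tau> :: "_ \<Rightarrow> int" where \<tau>: "\<forall>i\<in>S. (\<tau> i)\<^sup>2 = 1" "\<forall>i. i \<notin> S \<longrightarrow> \<tau> i = 0" "\<tau> None = 1" "sum \<tau> S = 1"
    using exists_signs_sum_1[OF fin(1) odd_S None] by blast
  obtain \<tau>' :: "_ \<Rightarrow> int" where \<tau>': "\<forall>i\<in>S'. (\<tau>' i)\<^sup>2 = 1" "\<forall>i. i \<notin> S' \<longrightarrow> \<tau>' i = 0" "sum \<tau>' S' = 1"
    using exists_signs_sum_1[OF fin(2) _ s'] odd_S eq by metis
  have sums: "sum \<tau> PL = 1" "sum \<tau>' PL = 1"
    using \<tau>(2,4) \<tau>'(2,3) sum.mono_neutral_right[OF finite_PL SS(1), of \<tau>]
      sum.mono_neutral_right[OF finite_PL SS(2), of \<tau>'] by auto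

  define P where "P x y = (\<Sum>i\<in>PL. \<tau> i * line i x y)" for x y
  define E where "E x y = (\<Sum>i\<in>PL. u i * sline i x y)" for x y
  define P' where "P' x y = (\<Sum>i\<in>PL. \<tau>' i * line i x y)" for x y
  define E' where "E' x y = (\<Sum>i\<in>PL. u' i * sline i x y)" for x y
  note defs = P_def[abs_def] E_def[abs_def] P'_def[abs_def] E'_def[abs_def]
  have per: "periodic2 P" "periodic2 E" "periodic2 P'" "periodic2 E'"
    unfolding defs by (intro periodic2_sum periodic2_line periodic2_sline)+
  have even: "P (- x) (- y) = P x y" "E (- x) (- y) = E x y" "P' (- x) (- y) = P' x y" "E' (- x) (- y) = E' x y" for x y
    by (simp_all add: defs line_even sline_even)
  have sq: "(\<tau> i)\<^sup>2 = of_bool (i \<in> S)" "(\<tau>' i)\<^sup>2 = of_bool (i \<in> S')"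
    "(u i)\<^sup>2 = of_bool (i \<in> S)" "(u' i)\<^sup>2 = of_bool (i \<in> S')" if "i \<in> PL" for i
    using \<tau>(1,2) \<tau>'(1,2) v[OF that] by (auto simp: u_def u'_def)
  have esq: "(\<Sum>j\<in>PL. eps i j * u j)\<^sup>2 = Q * of_bool (i \<notin> S)"
    "(\<Sum>j\<in>PL. eps i j * u' j)\<^sup>2 = Q * of_bool (i \<notin> S')" if "i \<in> PL" for i
    unfolding eu[OF that] power_mult_distrib sq(3,4)[OF that] using S'_iff[OF that] by simp_all
  have h: "conv P E x y = 0" "conv P P x y + conv E E x y = Q\<^sup>2 * (ind x * ind y)" for x y
    unfolding P_def[abs_def] E_def[abs_def]
    using half_plane_square[OF SS(1) cS(1) sq(1) sums(1) sq(3)] esq(1) by blast+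
  have h': "conv P' E' x y = 0" "conv P' P' x y + conv E' E' x y = Q\<^sup>2 * (ind x * ind y)" for x y
    unfolding P'_def[abs_def] E'_def[abs_def]
    using half_plane_square[OF SS(2) cS(2) sq(2) sums(2) sq(4)] esq(2) by blast+

  have at_0: "P x y = 1" "P' x y = 1" "E x y = 0" "E' x y = 0" if "\<eta> x = 0" "\<eta> y = 0" for x y
  proof -
    have "\<eta> (y - m * x) = 0" for m
      using that eta_add_zero[of "- (m * x)" y] by simp
    then have l: "line i x y = 1" "sline i x y = 0" for i
      using that by (cases i; simp add: ind_def)+
    show "P x y = 1" "P' x y = 1" "E x y = 0" "E' x y = 0"
      using sums by (simp_all add: P_def P'_def E_def E'_def l)
  qed
  have at_line: "\<exists>j\<in>PL. \<exists>c\<in>{1, -1}. P x y = \<tau> j \<and> E x y = c * u j \<and> P' x y = \<tau>' j \<and> E' x y = c * u' j \<and>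
      line j x y = 1"
    if nz: "\<not> (\<eta> x = 0 \<and> \<eta> y = 0)" for x y
  proof -
    obtain j c where j: "j \<in> PL" and c: "c \<in> {1, -1}"
      and jc: "\<And>i. i \<in> PL \<Longrightarrow> line i x y = of_bool (i = j) \<and> sline i x y = c * of_bool (i = j)"
      using point_on_line[OF nz] by blast
    have pick: "(\<Sum>i\<in>PL. h i * (d * of_bool (i = j))) = d * h j" for h :: "_ \<Rightarrow> int" and d
    proof -
      have "(\<Sum>i\<in>PL. h i * (d * of_bool (i = j))) = (\<Sum>i\<in>PL. if i = j then d * h i else 0)"
        by (intro sum.cong) auto
      then show ?thesis using j finite_PL by simp
    qed
    have "P x y = \<tau> j" "E x y = c * u j" "P' x y = \<tau>' j" "E' x y = c * u' j" "line j x y = 1"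
      using pick[of _ 1] pick[of _ c] jc j by (simp_all add: defs cong: sum.cong_simp)
    then show ?thesis using j c by blast
  qed

  \<comment> \<open>The order in the second pair is reversed: away from the origin \<open>P\<close>
    and \<open>E\<close> live on the lines in \<open>S\<close> and \<open>P'\<close> and
    \<open>E'\<close> on those in \<open>S'\<close>, while at the origin \<open>P\<close> and
    \<open>P'\<close> are 1 and the others 0.\<close>
  have "bush_seed T T (q\<^sup>2) (\<lambda>t x y. (if t then E else P) (fst x - fst y) (snd x - snd y))
    (\<lambda>t x y. (if t then P' else E') (fst x - fst y) (snd x - snd y))"
  proof
    show "card T = q\<^sup>2" by (rule card_T)
    show "q\<^sup>2 > 0" using q by simp
    show "orth_pair (T \<times> T) (q\<^sup>2) (\<lambda>t x y. (if t then E else P) (fst x - fst y) (snd x - snd y))"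
      by (rule orth_pair_conv[OF per(1,2) even(1,2) h])
    show "orth_pair (T \<times> T) (q\<^sup>2) (\<lambda>t x y. (if t then P' else E') (fst x - fst y) (snd x - snd y))"
    proof -
      have "(if t then P' else E') = (if \<not> t then E' else P')" for t by simp
      then show ?thesis
        using orth_pair_swap[OF orth_pair_conv[OF per(3,4) even(3,4) h']] by (simp only:)
    qed
  next
    fix t and x y :: "'r \<times> 'r"
    define z z' where "z = fst x - fst y" and "z' = snd x - snd y"
    show "\<bar>(if t then E else P) (fst x - fst y) (snd x - snd y)\<bar> +
        \<bar>(if t then P' else E') (fst x - fst y) (snd x - snd y)\<bar> = 1"
      unfolding z_def[symmetric] z'_def[symmetric]
    proof (cases "\<eta> z = 0 \<and> \<eta> z' = 0")
      case True
      then show "\<bar>(if t then E else P) z z'\<bar> + \<bar>(if t then P' else E') z z'\<bar> = 1"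
        using True at_0 by simp
    next
      case False
      obtain j c where j: "j \<in> PL" and c: "c \<in> {1, -1}" and e: "P z z' = \<tau> j" "E z z' = c * u j"
          "P' z z' = \<tau>' j" "E' z z' = c * u' j"
        using at_line[OF False] by blast
      have "\<bar>\<tau> j\<bar> = of_bool (j \<in> S)" "\<bar>\<tau>' j\<bar> = of_bool (j \<in> S')"
        using \<tau>(1,2) \<tau>'(1,2) by (auto simp: power2_eq_1_iff)
      moreover have "\<bar>c * u j\<bar> = of_bool (j \<in> S)" "\<bar>c * u' j\<bar> = of_bool (j \<in> S')"
        using v[OF j] c by (auto simp: u_def u'_def)
      ultimately show "\<bar>(if t then E else P) z z'\<bar> + \<bar>(if t then P' else E') z z'\<bar> = 1"
        using S'_iff[OF j] by (simp add: e)
    qed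
  next
    fix x y :: "'r \<times> 'r" assume xy: "fst x = fst y"
    have "P 0 (snd x - snd y) = 1"
    proof (cases "\<eta> (snd x - snd y) = 0")
      case True
      then show ?thesis using at_0 by simp
    next
      case False
      obtain j where j: "P 0 (snd x - snd y) = \<tau> j" "line j 0 (snd x - snd y) = 1"
        using at_line[of 0] False by blast
      then have "j = None" using False by (cases j) (simp_all add: ind_def)
      then show ?thesis using j \<tau>(3) by simp
    qed
    then show "(if False then E else P) (fst x - fst y) (snd x - snd y) = 1" using xy by simp
  next
    fix t x \<beta> assume x: "x \<in> T \<times> T" and \<beta>: "\<beta> \<in> T" and t: "t \<or> \<beta> \<noteq> fst x"
    have "(\<Sum>\<gamma>\<in>T. P (fst x - \<beta>) (snd x - \<gamma>)) = (\<Sum>i\<in>PL. \<tau> i * (if i = None then Q * ind (fst x - \<beta>) else 1))"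
      unfolding P_def by (subst sum.swap) (simp add: sum_line_block flip: sum_distrib_left)
    \<comment> \<open>The lines other than \<open>None\<close> have total weight
      \<open>1 - \<tau> None = 0\<close>.\<close>
    also have "\<dots> = Q * ind (fst x - \<beta>)"
      using sums(1) \<tau>(3) by (simp add: sum_PL)
    finally have P0: "(\<Sum>\<gamma>\<in>T. P (fst x - \<beta>) (snd x - \<gamma>)) = Q * ind (fst x - \<beta>)" .
    have "(\<Sum>\<gamma>\<in>T. E (fst x - \<beta>) (snd x - \<gamma>)) = (\<Sum>i\<in>PL. u i * (\<eta> (fst x - \<beta>) * eps None i))"
      unfolding E_def by (subst sum.swap) (simp add: sum_sline_block flip: sum_distrib_left)
    also have "\<dots> = \<eta> (fst x - \<beta>) * (\<Sum>i\<in>PL. eps None i * u i)"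
      unfolding sum_distrib_left by (intro sum.cong refl) (simp add: mult_ac)
    \<comment> \<open>The sum is \<open>q * u' None\<close>, and \<open>None\<close> lies outside
      \<open>S'\<close>.\<close>
    also have "\<dots> = 0"
      using eu(1)[of None] None SS by (auto simp: u'_def PL_def)
    finally have E0: "(\<Sum>\<gamma>\<in>T. E (fst x - \<beta>) (snd x - \<gamma>)) = 0" .
    show "(\<Sum>\<gamma>\<in>T. (if t then E else P) (fst x - fst (\<beta>, \<gamma>)) (snd x - snd (\<beta>, \<gamma>))) = 0"
      using P0 E0 t x \<beta> eta_diff_eq_0_iff[of "fst x" \<beta>] by (auto simp: ind_def)
  qed
  then show ?thesis by blast
qed

end

section \<open>Legendre symbols and the field of order the square of a prime\<close>

lemma Legendre_eq_0_iff: "Legendre a p = 0 \<longleftrightarrow> p dvd a"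
  by (simp add: Legendre_def cong_0_iff)

lemma Legendre_values: "Legendre a p \<in> {-1, 0, 1}"
  by (simp add: Legendre_def)

lemma Legendre_cong:
  assumes "[a = b] (mod p)"
  shows "Legendre a p = Legendre b p"
proof -
  have "[a = 0] (mod p) \<longleftrightarrow> [b = 0] (mod p)" "QuadRes p a \<longleftrightarrow> QuadRes p b"
    using assms unfolding QuadRes_def by (meson cong_sym cong_trans)+
  then show ?thesis by (simp add: Legendre_def)
qed

lemma Legendre_square:
  assumes "\<not> p dvd a" "prime p"
  shows "Legendre (a\<^sup>2) p = 1"
proof -
  have "QuadRes p (a\<^sup>2)" unfolding QuadRes_def by (rule exI[of _ a]) (rule cong_refl)
  then show ?thesis using assms by (simp add: Legendre_def cong_0_iff prime_dvd_power_iff)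
qed

text \<open>Euler's criterion gives a congruence modulo \<open>p\<close> between numbers that differ
  by at most 2.\<close>

lemma Legendre_mult:
  assumes "prime p" "p > 2"
  shows "Legendre (a * b) (int p) = Legendre a (int p) * Legendre b (int p)"
proof -
  define k where "k = (p - 1) div 2"
  have e: "[Legendre c (int p) = c ^ k] (mod int p)" for c
    unfolding k_def using euler_criterion[OF assms] .
  have "[Legendre (a * b) (int p) = Legendre a (int p) * Legendre b (int p)] (mod int p)"
    using e[of "a * b"] cong_mult[OF e[of a] e[of b]] by (metis power_mult_distrib cong_sym cong_trans)
  then have "int p dvd Legendre (a * b) (int p) - Legendre a (int p) * Legendre b (int p)"
    by (simp add: cong_iff_dvd_diff)
  moreover have "\<bar>Legendre (a * b) (int p) - Legendre a (int p) * Legendre b (int p)\<bar> < int p"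
  proof -
    have "\<bar>x - y * z\<bar> \<le> 2" if "x \<in> {-1, 0, 1}" "y \<in> {-1, 0, 1}" "z \<in> {-1, 0, 1}" for x y z :: int
      using that by auto
    from this[OF Legendre_values Legendre_values Legendre_values]
    have "\<bar>Legendre (a * b) (int p) - Legendre a (int p) * Legendre b (int p)\<bar> \<le> 2" .
    then show ?thesis using assms(2) by linarith
  qed
  ultimately show ?thesis using zdvd_not_zless dvd_imp_le_int[of "Legendre (a * b) (int p) - _"] by fastforce
qed

text \<open>Otherwise squaring is onto, hence injective, on the nonzero residues; but 1 and
  \<open>p - 1\<close> have the same square.\<close>

lemma nonresidue_exists:
  assumes "prime p" "p > 2"
  shows "\<exists>a. Legendre a (int p) = -1"
proof (rule ccontr)
  assume no: "\<nexists>a. Legendre a (int p) = -1"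
  define A where "A = {1..<int p}"
  have res: "QuadRes (int p) a" if "a \<in> A" for a
    using no that by (auto simp: Legendre_def A_def cong_0_iff zdvd_not_zless split: if_splits)
  have "A \<subseteq> (\<lambda>y. y\<^sup>2 mod int p) ` A"
  proof
    fix a assume a: "a \<in> A"
    then obtain y where y: "[y\<^sup>2 = a] (mod int p)" using res unfolding QuadRes_def by blast
    then have ya: "y\<^sup>2 mod int p = a" using a by (simp add: cong_def A_def)
    have "y mod int p \<noteq> 0"
    proof
      assume "y mod int p = 0"
      then have "int p dvd y\<^sup>2" by (simp add: mod_eq_0_iff_dvd power2_eq_square)
      then show False using ya a by (simp add: A_def)
    qed
    moreover have "0 \<le> y mod int p" "y mod int p < int p" using assms by simp_all
    ultimately have "y mod int p \<in> A" by (simp add: A_def)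
    moreover have "(y mod int p)\<^sup>2 mod int p = a" using ya by (simp add: power_mod)
    ultimately show "a \<in> (\<lambda>y. y\<^sup>2 mod int p) ` A" by blast
  qed
  then have "card A \<le> card ((\<lambda>y. y\<^sup>2 mod int p) ` A)"
    by (intro card_mono) (simp_all add: A_def)
  then have "card ((\<lambda>y. y\<^sup>2 mod int p) ` A) = card A"
    by (intro antisym card_image_le) (simp_all add: A_def)
  then have inj: "inj_on (\<lambda>y. y\<^sup>2 mod int p) A"
    by (intro eq_card_imp_inj_on) (simp_all add: A_def)
  have "(int p - 1)\<^sup>2 = 1 + int p * (int p - 2)" by (simp add: power2_eq_square algebra_simps)
  then have "(int p - 1)\<^sup>2 mod int p = 1\<^sup>2 mod int p" by simp
  then have "int p - 1 = 1"
    using inj assms by (auto simp: inj_on_def A_def)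
  then show False using assms by simp
qed

lemma sum_mod_affine:
  fixes f :: "int \<Rightarrow> int"
  assumes "prime p" "\<not> int p dvd k" and f: "\<And>x y. [x = y] (mod int p) \<Longrightarrow> f x = f y"
  shows "(\<Sum>a\<in>{0..<int p}. f (c + k * a)) = (\<Sum>a\<in>{0..<int p}. f a)"
proof -
  define r where "r a = (c + k * a) mod int p" for a
  have p: "int p > 0" using assms(1) by (simp add: prime_gt_0_nat)
  have inj: "inj_on r {0..<int p}"
  proof (rule inj_onI)
    fix a b assume ab: "a \<in> {0..<int p}" "b \<in> {0..<int p}" "r a = r b"
    then have "int p dvd k * (a - b)"
      by (simp add: r_def mod_eq_dvd_iff algebra_simps)
    then have "int p dvd a - b"
      using assms by (simp add: prime_dvd_mult_iff)
    then show "a = b" using ab by (simp add: mod_eq_dvd_iff[symmetric])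
  qed
  moreover have "r ` {0..<int p} \<subseteq> {0..<int p}" using p by (auto simp: r_def)
  ultimately have "bij_betw r {0..<int p} {0..<int p}"
    by (simp add: bij_betw_def endo_inj_surj)
  then have "(\<Sum>a\<in>{0..<int p}. f (r a)) = (\<Sum>a\<in>{0..<int p}. f a)"
    by (rule sum.reindex_bij_betw)
  moreover have "f (r a) = f (c + k * a)" for a
    by (rule f) (simp add: r_def cong_def)
  ultimately show ?thesis by simp
qed

text \<open>The field of order \<open>p\<^sup>2\<close> is the quotient of the integer polynomials by the ideal generated by \<open>p\<close> and
  \<open>X\<^sup>2 - \<nu>\<close>, and \<open>red f\<close> consists of the coefficients of 1 and \<open>X\<close> in \<open>f\<close> modulo \<open>X\<^sup>2 - \<nu>\<close>.\<close>

locale prime_nonresidue =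
  fixes p :: nat and \<nu> :: int
  assumes prime_p: "prime p" and p_gt_2: "p > 2" and \<nu>: "Legendre \<nu> (int p) = -1"
begin

definition red :: "int poly \<Rightarrow> int \<times> int" where
  "red f = fold_coeffs (\<lambda>a xy. (a + \<nu> * snd xy, fst xy)) f (0, 0)"

definition re :: "int poly \<Rightarrow> int" where "re f = fst (red f)"
definition im :: "int poly \<Rightarrow> int" where "im f = snd (red f)"

lemma re_im_0 [simp]: "re 0 = 0" "im 0 = 0"
  by (simp_all add: re_def im_def red_def)

lemma re_im_pCons [simp]: "re (pCons a f) = a + \<nu> * im f" "im (pCons a f) = re f"
  by (cases "f = 0"; cases "a = 0"; simp add: re_def im_def red_def fold_coeffs_pCons_not_0_0_eq)+

lemma re_im_add [simp]: "re (f + g) = re f + re g" "im (f + g) = im f + im g"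
  by (induction f g rule: poly_induct2) (simp_all add: algebra_simps)

lemma re_im_minus [simp]: "re (- f) = - re f" "im (- f) = - im f"
  using re_im_add[of f "- f"] by simp_all

lemma re_im_diff [simp]: "re (f - g) = re f - re g" "im (f - g) = im f - im g"
  using re_im_add[of f "- g"] by simp_all

lemma re_im_smult [simp]: "re (smult c f) = c * re f" "im (smult c f) = c * im f"
  by (induction f) (simp_all add: algebra_simps)

lemma re_im_mult: "re (f * g) = re f * re g + \<nu> * (im f * im g)" "im (f * g) = re f * im g + im f * re g"
  by (induction f) (simp_all add: algebra_simps)

definition nrm :: "int poly \<Rightarrow> int" where "nrm f = (re f)\<^sup>2 - \<nu> * (im f)\<^sup>2"

lemma nrm_mult: "nrm (f * g) = nrm f * nrm g"
  by (simp add: nrm_def re_im_mult power2_eq_square algebra_simps)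

text \<open>The norm is the power with exponent \<open>p + 1\<close>, so by Euler's criterion this
  is the power with exponent \<open>(p\<^sup>2 - 1) / 2\<close>, the quadratic character of the
  field.\<close>

definition \<eta> :: "int poly \<Rightarrow> int" where "\<eta> f = Legendre (nrm f) (int p)"

lemma prime_int_p: "prime (int p)"
  using prime_p by simp

text \<open>The norm form is anisotropic: a nontrivial zero would make \<open>\<nu>\<close> a
  square.\<close>

lemma eta_eq_0_iff: "\<eta> f = 0 \<longleftrightarrow> int p dvd re f \<and> int p dvd im f"
proof
  assume "\<eta> f = 0"
  then have d: "int p dvd (re f)\<^sup>2 - \<nu> * (im f)\<^sup>2" by (simp add: \<eta>_def Legendre_eq_0_iff nrm_def)
  have "int p dvd im f"
  proof (rule ccontr)
    assume n: "\<not> int p dvd im f"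
    have "[(re f)\<^sup>2 = \<nu> * (im f)\<^sup>2] (mod int p)" using d by (simp add: cong_iff_dvd_diff)
    then have "Legendre ((re f)\<^sup>2) (int p) = - 1"
      using Legendre_square[OF n prime_int_p]
      by (simp add: Legendre_cong Legendre_mult[OF prime_p p_gt_2] \<nu>)
    then show False
      using Legendre_square[OF _ prime_int_p, of "re f"] Legendre_eq_0_iff[of "(re f)\<^sup>2" "int p"]
      by (cases "int p dvd re f") (auto simp: power2_eq_square)
  qed
  moreover from this have "int p dvd (re f)\<^sup>2"
    using dvd_add[OF d, of "\<nu> * (im f)\<^sup>2"] by (simp add: power2_eq_square)
  ultimately show "int p dvd re f \<and> int p dvd im f"
    using prime_int_p prime_dvd_power by blast
next
  assume "int p dvd re f \<and> int p dvd im f"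
  then show "\<eta> f = 0" by (auto simp: \<eta>_def Legendre_eq_0_iff nrm_def power2_eq_square)
qed

text \<open>Suppose that all nonzero norms are squares. Then so is \<open>-\<nu>\<close>, the norm
  of \<open>X\<close>; dividing by its root gives \<open>b\<close> with
  \<open>-\<nu> * b\<^sup>2\<close> congruent to 1. Now \<open>r\<^sup>2 + 1\<close> is the norm of
  \<open>[:r, b:]\<close>, so by induction 1, ..., \<open>p - 1\<close> are all squares, contrary to
  the choice of \<open>\<nu>\<close>.\<close>

lemma exists_norm_nonresidue: "\<exists>e. \<eta> e = -1"
proof (rule ccontr)
  assume no: "\<nexists>e. \<eta> e = -1"
  have N: "Legendre (a\<^sup>2 - \<nu> * b\<^sup>2) (int p) \<in> {0, 1}" for a b
    using no Legendre_values[of "a\<^sup>2 - \<nu> * b\<^sup>2" "int p"] by (force simp: \<eta>_def nrm_def dest: spec[of _ "[:a, b:]"])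
  have "\<not> int p dvd - \<nu>" using \<nu> Legendre_eq_0_iff[of \<nu> "int p"] by auto
  then have "Legendre (- \<nu>) (int p) = 1"
    using N[of 0 1] Legendre_eq_0_iff[of "- \<nu>" "int p"] by auto
  then obtain c where c: "[c\<^sup>2 = - \<nu>] (mod int p)"
    by (auto simp: Legendre_def QuadRes_def split: if_splits)
  have "\<not> int p dvd c"
    using cong_dvd_iff[OF c] \<open>\<not> int p dvd - \<nu>\<close> by (auto simp: power2_eq_square)
  then have "coprime c (int p)"
    using prime_imp_coprime[OF prime_int_p] coprime_commute by blast
  then obtain b where b: "[c * b = 1] (mod int p)" using cong_solve_coprime_int by blast
  have "[- \<nu> * b\<^sup>2 = c\<^sup>2 * b\<^sup>2] (mod int p)" using c by (intro cong_mult) (simp_all add: cong_sym)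
  also have "c\<^sup>2 * b\<^sup>2 = (c * b)\<^sup>2" by (simp add: power_mult_distrib)
  also have "[(c * b)\<^sup>2 = 1\<^sup>2] (mod int p)" by (rule cong_pow[OF b])
  finally have b1: "[- \<nu> * b\<^sup>2 = 1] (mod int p)" by simp
  have pos: "Legendre (int k) (int p) = 1" if "1 \<le> k" "k < p" for k
    using that
  proof (induction k rule: nat_induct_at_least)
    case base
    show ?case using Legendre_square[OF _ prime_int_p, of 1] p_gt_2 by simp
  next
    case (Suc k)
    then obtain r where r: "[r\<^sup>2 = int k] (mod int p)"
      by (auto simp: Legendre_def QuadRes_def split: if_splits)
    have "[r\<^sup>2 - \<nu> * b\<^sup>2 = int (Suc k)] (mod int p)"
      using cong_add[OF r b1] by (simp add: algebra_simps)
    then have "Legendre (int (Suc k)) (int p) \<in> {0, 1}" using N[of r b] Legendre_cong by metis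
    moreover have "\<not> int p dvd int (Suc k)" using Suc.prems by (simp only: int_dvd_int_iff) (simp add: nat_dvd_not_less)
    ultimately show ?case by (simp add: Legendre_eq_0_iff)
  qed
  have "\<nu> mod int p \<noteq> 0" using \<open>\<not> int p dvd - \<nu>\<close> by auto
  then have "1 \<le> nat (\<nu> mod int p)" "nat (\<nu> mod int p) < p"
    using p_gt_2 pos_mod_bound[of "int p" \<nu>] pos_mod_sign[of "int p" \<nu>] by linarith+
  then have "Legendre (\<nu> mod int p) (int p) = 1" using pos[of "nat (\<nu> mod int p)"] p_gt_2 by simp
  then show False using Legendre_cong[of "\<nu> mod int p" \<nu> "int p"] \<nu> by simp
qed

definition T :: "int poly set" where "T = (\<lambda>(a, b). [:a, b:]) ` ({0..<int p} \<times> {0..<int p})"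

lemma sum_T: "sum h T = (\<Sum>a\<in>{0..<int p}. \<Sum>b\<in>{0..<int p}. h [:a, b:])"
proof -
  have "inj_on (\<lambda>(a, b). [:a, b:]) ({0..<int p} \<times> {0..<int p})" by (auto simp: inj_on_def)
  then show ?thesis by (simp add: T_def sum.reindex sum.cartesian_product case_prod_unfold)
qed

sublocale quadratic_residues \<eta> T p
proof
  show "\<eta> (f * g) = \<eta> f * \<eta> g" for f g
    by (simp add: \<eta>_def nrm_mult Legendre_mult[OF prime_p p_gt_2])
  show "\<eta> f \<in> {-1, 0, 1}" for f unfolding \<eta>_def by (rule Legendre_values)
  show "\<eta> f = \<eta> g" if "\<eta> (f - g) = 0" for f g
  proof -
    have "[re f = re g] (mod int p)" "[im f = im g] (mod int p)"
      using that by (simp_all add: eta_eq_0_iff cong_iff_dvd_diff)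
    then have "[nrm f = nrm g] (mod int p)"
      unfolding nrm_def by (intro cong_diff cong_mult cong_pow) simp_all
    then show ?thesis unfolding \<eta>_def by (rule Legendre_cong)
  qed
  have 1: "Legendre 1 (int p) = 1"
    using Legendre_square[OF _ prime_int_p, of 1] p_gt_2 by simp
  show "\<eta> 1 = 1" "\<eta> (-1) = 1"
    using 1 by (simp_all add: \<eta>_def nrm_def one_pCons)
  show "finite T" by (simp add: T_def)
  have "inj_on (\<lambda>(a, b). [:a, b:]) ({0..<int p} \<times> {0..<int p})" by (auto simp: inj_on_def)
  then show "card T = p\<^sup>2" by (simp add: T_def card_image card_cartesian_product power2_eq_square)
  show "\<exists>t\<in>T. \<eta> (f - t) = 0" for f
    using p_gt_2
    by (intro bexI[of _ "[:re f mod int p, im f mod int p:]"]) (auto simp: eta_eq_0_iff T_def)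
  show "s = t" if "s \<in> T" "t \<in> T" "\<eta> (s - t) = 0" for s t
    using that by (auto simp: T_def eta_eq_0_iff mod_eq_dvd_iff[symmetric])
  show "\<exists>g. \<eta> (f * g - 1) = 0" if "\<eta> f \<noteq> 0" for f
  proof -
    have "\<not> int p dvd nrm f" using that by (simp add: \<eta>_def Legendre_eq_0_iff)
    then have "coprime (nrm f) (int p)"
      using prime_imp_coprime[OF prime_int_p] coprime_commute by blast
    then obtain k where k: "[nrm f * k = 1] (mod int p)" using cong_solve_coprime_int by blast
    \<comment> \<open>The inverse is the conjugate divided by the norm.\<close>
    have "re (f * [:re f * k, - im f * k:] - 1) = nrm f * k - 1"
      by (simp add: re_im_mult nrm_def one_pCons power2_eq_square algebra_simps)
    moreover have "im (f * [:re f * k, - im f * k:] - 1) = 0"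
      by (simp add: re_im_mult one_pCons)
    ultimately have "\<eta> (f * [:re f * k, - im f * k:] - 1) = 0"
      using k by (simp add: eta_eq_0_iff cong_iff_dvd_diff)
    then show ?thesis by blast
  qed
  show "\<exists>e. \<eta> e = -1" by (rule exists_norm_nonresidue)
  show "odd p" using prime_p p_gt_2 by (simp add: prime_odd_nat)
qed

section \<open>Eigenvectors from lines over the prime field\<close>

definition row_sum :: "int \<Rightarrow> int" where
  "row_sum b = (\<Sum>a\<in>{0..<int p}. Legendre (a\<^sup>2 - \<nu> * b\<^sup>2) (int p))"

lemma row_sum_shift: "(\<Sum>a\<in>{0..<int p}. Legendre ((c - a)\<^sup>2 - \<nu> * b\<^sup>2) (int p)) = row_sum b"
proof -
  have "\<not> int p dvd - 1" using p_gt_2 by simp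
  from sum_mod_affine[OF prime_p this, of "\<lambda>a. Legendre (a\<^sup>2 - \<nu> * b\<^sup>2) (int p)" c]
  show ?thesis unfolding row_sum_def
    by (simp add: Legendre_cong cong_diff cong_pow)
qed

text \<open>Nonzero elements of the prime field have square norms, which settles the row of the
  prime field itself. Scaling shows that the other \<open>p - 1\<close> rows have equal sums, and
  all rows together sum to 0.\<close>

lemma row_sum_eq: "row_sum b = int p * of_bool (int p dvd b) - 1"
proof -
  have p0: "{0..<int p} = insert 0 {1..<int p}" using p_gt_2 by auto
  have zero: "row_sum b = int p - 1" if "int p dvd b" for b
  proof -
    have "Legendre (a\<^sup>2 - \<nu> * b\<^sup>2) (int p) = Legendre (a\<^sup>2) (int p)" for a
      using that by (intro Legendre_cong) (simp add: cong_iff_dvd_diff power2_eq_square)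
    then have "row_sum b = (\<Sum>a\<in>{0..<int p}. Legendre (a\<^sup>2) (int p))" by (simp add: row_sum_def)
    also have "\<dots> = (\<Sum>a\<in>{1..<int p}. 1)"
      unfolding p0 using Legendre_eq_0_iff[of 0 "int p"]
      by (simp add: Legendre_square[OF _ prime_int_p] zdvd_not_zless)
    finally show ?thesis using p_gt_2 by simp
  qed
  have scale: "row_sum b = row_sum 1" if "\<not> int p dvd b" for b
  proof -
    have "row_sum b = (\<Sum>a\<in>{0..<int p}. Legendre ((0 + b * a)\<^sup>2 - \<nu> * b\<^sup>2) (int p))"
      unfolding row_sum_def
      by (rule sum_mod_affine[OF prime_p that, symmetric]) (intro Legendre_cong cong_diff cong_pow cong_refl)
    also have "\<dots> = (\<Sum>a\<in>{0..<int p}. Legendre (b\<^sup>2 * (a\<^sup>2 - \<nu> * 1\<^sup>2)) (int p))"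
      by (simp add: power2_eq_square algebra_simps)
    also have "\<dots> = row_sum 1"
      by (simp add: row_sum_def Legendre_mult[OF prime_p p_gt_2] Legendre_square[OF that prime_int_p])
    finally show ?thesis .
  qed
  have "0 = (\<Sum>b\<in>{0..<int p}. row_sum b)"
    using sum_eta unfolding sum_T row_sum_def by (subst sum.swap) (simp add: \<eta>_def nrm_def)
  also have "\<dots> = row_sum 0 + (\<Sum>b\<in>{1..<int p}. row_sum b)"
    unfolding p0 by simp
  also have "(\<Sum>b\<in>{1..<int p}. row_sum b) = (\<Sum>b\<in>{1..<int p}. row_sum 1)"
    by (intro sum.cong refl scale) (simp add: zdvd_not_zless)
  finally have "0 = (int p - 1) * 1 + (int p - 1) * row_sum 1"
    using p_gt_2 by (simp add: zero)
  then have "0 = (int p - 1) * (1 + row_sum 1)" by (simp only: distrib_left)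
  then have "row_sum 1 = -1" using p_gt_2 by simp
  then show ?thesis using zero scale by (cases "int p dvd b") simp_all
qed

text \<open>A function of \<open>im\<close> is constant on the rows, so only row sums of
  \<open>\<eta>\<close> matter. If \<open>F\<close> sums to 1, the value 1 at infinity cancels the
  last term and leaves an eigenvector for \<open>p\<close>.\<close>

lemma sum_eta_im:
  assumes F: "\<And>x y. [x = y] (mod int p) \<Longrightarrow> F x = F y"
  shows "(\<Sum>s\<in>T. \<eta> (t - s) * F (im s)) = int p * F (im t) - (\<Sum>b\<in>{0..<int p}. F b)"
proof -
  have "(\<Sum>s\<in>T. \<eta> (t - s) * F (im s)) = (\<Sum>b\<in>{0..<int p}. row_sum (im t - b) * F b)"
    unfolding sum_T by (subst sum.swap)
      (simp add: \<eta>_def nrm_def row_sum_shift flip: sum_distrib_right)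
  also have "\<dots> = (\<Sum>b\<in>{0..<int p}. (if b = im t mod int p then int p * F (im t) else 0) - F b)"
  proof (intro sum.cong refl)
    fix b assume "b \<in> {0..<int p}"
    then have "int p dvd im t - b \<longleftrightarrow> b = im t mod int p"
      by (auto simp: mod_eq_dvd_iff[symmetric])
    moreover have "F (im t mod int p) = F (im t)" by (rule F) simp
    ultimately show "row_sum (im t - b) * F b = (if b = im t mod int p then int p * F (im t) else 0) - F b"
      by (auto simp: row_sum_eq algebra_simps)
  qed
  also have "\<dots> = int p * F (im t) - (\<Sum>b\<in>{0..<int p}. F b)"
    using p_gt_2 by (simp add: sum_subtractf)
  finally show ?thesis .
qed

lemma prime_seed: "\<exists>a b. bush_seed T T (p\<^sup>2) a b"
proof -
  \<comment> \<open>There is one more value 1 than -1, so the values over a full period sum to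
    1.\<close>
  define F where "F x = (if x mod int p \<le> (int p - 1) div 2 then 1 else -1 :: int)" for x
  have F_cong: "F x = F y" if "[x = y] (mod int p)" for x y using that by (simp add: F_def cong_def)
  obtain l where l: "p = 2 * l + 1" using odd_q by (elim oddE)
  have "(\<Sum>b\<in>{0..<int p}. F b) = (\<Sum>b\<in>{0..int l}. F b) + (\<Sum>b\<in>{int l + 1..<int p}. F b)"
    by (subst sum.union_disjoint[symmetric]) (auto simp: l intro: sum.cong)
  also have "\<dots> = (\<Sum>b\<in>{0..int l}. 1) + (\<Sum>b\<in>{int l + 1..<int p}. -1)"
    by (intro arg_cong2[where f = "(+)"] sum.cong refl) (auto simp: F_def l)
  finally have F_sum: "(\<Sum>b\<in>{0..<int p}. F b) = 1" by (simp add: l)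
  obtain e where e: "\<eta> e = -1" using exists_norm_nonresidue by blast
  have per: "periodic (\<lambda>s. F (im s))"
    unfolding periodic_def by (auto simp: eta_eq_0_iff cong_iff_dvd_diff intro!: F_cong)
  have F_T: "(\<Sum>s\<in>T. F (im s)) = int p"
    unfolding sum_T using F_sum by simp
  define v where "v = case_option 1 (\<lambda>s. F (im s))"
  \<comment> \<open>Scaling by the nonresidue \<open>e\<close> changes the sign of the eigenvalue;
    the minus sign in front keeps the value at infinity equal to 1.\<close>
  define w where "w = case_option 1 (\<lambda>s. - F (im (e * s)))"
  show ?thesis
  proof (rule bush_seed_exists[of v w])
    show "v i \<in> {1, -1}" "w i \<in> {1, -1}" for i
      by (cases i; simp add: v_def w_def F_def)+
    show "v None = w None" by (simp add: v_def w_def)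
    show "(\<Sum>j\<in>PL. eps i j * v j) = int p * v i" for i
      using sum_eta_im[of F, OF F_cong] F_T F_sum by (cases i) (simp_all add: sum_PL v_def)
    show "(\<Sum>j\<in>PL. eps i j * w j) = - int p * w i" for i
    proof (cases i)
      case None
      then show ?thesis using sum_scale[OF per, of e] F_T e by (simp add: sum_PL w_def sum_negf)
    next
      case (Some t)
      have "(\<Sum>s\<in>T. \<eta> (t - s) * F (im (e * s))) = (\<Sum>s\<in>T. - (\<eta> (e * t - e * s) * F (im (e * s))))"
        using e by (simp add: eta_mult flip: right_diff_distrib)
      also have "\<dots> = - (\<Sum>s\<in>T. \<eta> (e * t - s) * F (im s))"
        using sum_scale[OF periodic_mult[OF periodic_eta_diff[of "e * t"] per], of e] e
        by (simp add: sum_negf)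
      also have "\<dots> = - (int p * F (im (e * t)) - 1)"
        using sum_eta_im[of F, OF F_cong] F_sum by simp
      finally show ?thesis using Some by (simp add: sum_PL w_def sum_negf)
    qed
  qed
qed

end

section \<open>Odd primes and their products\<close>

lemma odd_prime_seed:
  assumes "prime p" "p > 2"
  shows "\<exists>a b. bush_seed {..<p\<^sup>2} {..<p\<^sup>2} (p\<^sup>2) a b"
proof -
  obtain \<nu> where "Legendre \<nu> (int p) = -1" using nonresidue_exists[OF assms] by blast
  then interpret prime_nonresidue p \<nu> using assms by unfold_locales
  show ?thesis using prime_seed bush_seed.nat_seed by blast
qed

lemma odd_seed:
  assumes "odd m"
  shows "\<exists>a b. bush_seed {..<m\<^sup>2} {..<m\<^sup>2} (m\<^sup>2) a b"
  using assms
proof (induction m rule: prime_divisors_induct)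
  case (unit m)
  then show ?case using bush_seed_1 by auto
next
  case (factor p m)
  have "p > 2" using factor prime_ge_2_nat[of p] by (cases "p = 2") auto
  then obtain a b where 1: "bush_seed {..<p\<^sup>2} {..<p\<^sup>2} (p\<^sup>2) a b" using odd_prime_seed factor by blast
  obtain a' b' where 2: "bush_seed {..<m\<^sup>2} {..<m\<^sup>2} (m\<^sup>2) a' b'" using factor by auto
  show ?case
    using bush_seed_mult[OF 1 2] bush_seed.nat_seed by (metis power_mult_distrib)
qed simp

theorem theorem3p5:
  fixes m :: int
  assumes "odd m"
  shows "\<exists>H. bush_type_hadamard_mat (nat (4 * m ^ 4)) H \<and> transpose_mat H = H"
proof -
  \<comment> \<open>The order depends only on the absolute value of \<open>m\<close>, so negative
    \<open>m\<close> are covered.\<close>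
  have "odd (nat \<bar>m\<bar>)" using assms by (simp add: even_nat_iff)
  then obtain a b where "bush_seed {..<(nat \<bar>m\<bar>)\<^sup>2} {..<(nat \<bar>m\<bar>)\<^sup>2} ((nat \<bar>m\<bar>)\<^sup>2) a b"
    using odd_seed by blast
  then have "\<exists>H. bush_type_hadamard_mat (4 * ((nat \<bar>m\<bar>)\<^sup>2)\<^sup>2) H \<and> transpose_mat H = H"
    by (rule bush_seed_imp_bush_type)
  moreover have "4 * ((nat \<bar>m\<bar>)\<^sup>2)\<^sup>2 = nat (4 * m ^ 4)"
    by (simp add: nat_mult_distrib flip: nat_power_eq power_mult)
  ultimately show ?thesis by simp
qed

end
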